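(* Let $t\ge 2$ be an integer and let $\kappa>0$ be a real number. As $r,s\to\infty$ (through positive integers) so that $s/r\to\kappa$, the random variable $$\frac{t\,|\mathrm{core}_t(\lambda)|}{r},$$ where $\lambda$ is a uniformly random partition in $\mathcal{P}_{r,s}$, converges in distribution to a Gamma-distributed random variable with shape parameter $\alpha=\frac{t-1}{2}$ and rate parameter $\beta=\frac{1+\kappa}{\kappa t}$.
   Context: A partition $\lambda=(\lambda_1\ge\lambda_2\ge\cdots)$ is a weakly decreasing finite sequence of positive integers (possibly empty); $\ell(\lambda)$ is its number of parts and $|\lambda|=\sum_j\lambda_j$ its size. $\mathcal{P}_{r,s}$ is the (finite) set of partitions with $\ell(\lambda)\le r$ and $\lambda_1\le s$ (with $\lambda_1=0$ for the empty partition). A rim-hook of $\lambda$ is a connected skew shape $\lambda/\mu$ (with $\mu\subseteq\lambda$ a partition) containing no $2\times2$ block of boxes; a $t$-rim hook is one with exactly $t$ boxes. The $t$-core $\mathrm{core}_t(\lambda)$ is the partition obtained by successively removing $t$-rim hooks until none can be removed (it does not depend on the order of removals). The Gamma distribution with shape $\alpha>0$ and rate $\beta>0$ is the distribution on $(0,\infty)$ with density $\frac{\beta^\alpha}{\Gamma(\alpha)}x^{\alpha-1}e^{-\beta x}$. *)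

theory Defs
  imports "HOL-Probability.Probability"
begin

section \<open>Integer partitions\<close>

definition is_partition :: "nat list \<Rightarrow> bool" where
  "is_partition l \<longleftrightarrow> sorted_wrt (\<ge>) l \<and> (\<forall>x\<in>set l. 0 < x)"

abbreviation partition_size :: "nat list \<Rightarrow> nat" where
  "partition_size \<equiv> sum_list"

definition first_part :: "nat list \<Rightarrow> nat" where
  "first_part l = (case l of [] \<Rightarrow> 0 | x # _ \<Rightarrow> x)"

definition box_partitions :: "nat \<Rightarrow> nat \<Rightarrow> nat list set" where
  "box_partitions r s = {l. is_partition l \<and> length l \<le> r \<and> first_part l \<le> s}"

text \<open>Uniform distributions (\<open>pmf_of_set\<close>) require a finite nonempty set.\<close>

lemma finite_box_partitions: "finite (box_partitions r s)"
proof (rule finite_subset)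
  show "box_partitions r s \<subseteq> {l. set l \<subseteq> {..s} \<and> length l \<le> r}"
  proof
    fix l assume "l \<in> box_partitions r s"
    then show "l \<in> {l. set l \<subseteq> {..s} \<and> length l \<le> r}"
      by (cases l) (auto simp: box_partitions_def is_partition_def first_part_def)
  qed
  show "finite {l. set l \<subseteq> {..s} \<and> length l \<le> r}"
    by (rule finite_lists_length_le) simp
qed

lemma box_partitions_nonempty: "box_partitions r s \<noteq> {}"
proof -
  have "[] \<in> box_partitions r s"
    by (simp add: box_partitions_def is_partition_def first_part_def)
  then show ?thesis by blast
qed

section \<open>Rim hooks and cores\<close>

text \<open>Boxes are pairs (row, column), both counted from zero.\<close>

definition diagram :: "nat list \<Rightarrow> (nat \<times> nat) set" where
  "diagram l = {(i, j). i < length l \<and> j < l ! i}"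

definition box_adjacent :: "nat \<times> nat \<Rightarrow> nat \<times> nat \<Rightarrow> bool" where
  "box_adjacent a b \<longleftrightarrow>
     (fst a = fst b \<and> (snd b = Suc (snd a) \<or> snd a = Suc (snd b))) \<or>
     (snd a = snd b \<and> (fst b = Suc (fst a) \<or> fst a = Suc (fst b)))"

text \<open>Connectedness of a set of boxes is through common edges; boxes that only share a corner
  are not adjacent.\<close>

definition boxes_connected :: "(nat \<times> nat) set \<Rightarrow> bool" where
  "boxes_connected S \<longleftrightarrow> S \<noteq> {} \<and>
     (\<forall>a\<in>S. \<forall>b\<in>S. (\<lambda>x y. x \<in> S \<and> y \<in> S \<and> box_adjacent x y)\<^sup>*\<^sup>* a b)"

definition has_2x2_block :: "(nat \<times> nat) set \<Rightarrow> bool" where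
  "has_2x2_block S \<longleftrightarrow>
     (\<exists>i j. (i, j) \<in> S \<and> (i, Suc j) \<in> S \<and> (Suc i, j) \<in> S \<and> (Suc i, Suc j) \<in> S)"

text \<open>\<open>remove_rim_hook t l m\<close>: the partition \<open>m\<close> arises from the partition \<open>l\<close> by removing
  one rim hook with exactly \<open>t\<close> boxes.\<close>

definition remove_rim_hook :: "nat \<Rightarrow> nat list \<Rightarrow> nat list \<Rightarrow> bool" where
  "remove_rim_hook t l m \<longleftrightarrow>
     is_partition l \<and> is_partition m \<and> diagram m \<subseteq> diagram l \<and>
     boxes_connected (diagram l - diagram m) \<and>
     \<not> has_2x2_block (diagram l - diagram m) \<and>
     card (diagram l - diagram m) = t"

text \<open>The description is meaningful because the result of removing \<open>t\<close>-rim hooks until none is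
  left does not depend on the order of removals.\<close>

definition core :: "nat \<Rightarrow> nat list \<Rightarrow> nat list" where
  "core t l = (THE m. (remove_rim_hook t)\<^sup>*\<^sup>* l m \<and> (\<nexists>m'. remove_rim_hook t m m'))"

section \<open>The Gamma distribution\<close>

definition gamma_density :: "real \<Rightarrow> real \<Rightarrow> real \<Rightarrow> real" where
  "gamma_density \<alpha> \<beta> x =
     (if 0 < x then \<beta> powr \<alpha> / Gamma \<alpha> * x powr (\<alpha> - 1) * exp (- \<beta> * x) else 0)"

definition gamma_distribution :: "real \<Rightarrow> real \<Rightarrow> real measure" where
  "gamma_distribution \<alpha> \<beta> = density lborel (\<lambda>x. ennreal (gamma_density \<alpha> \<beta> x))"

end

theory Submission
  imports Defs
begin

text \<open>
  Encode a partition in the \<open>r \<times> s\<close> box by its beta set, an \<open>r\<close>-subset \<open>B\<close> of \<open>{..<r + s}\<close>.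
  Removing a \<open>t\<close>-rim hook replaces some \<open>b + t \<in> B\<close> by a missing \<open>b\<close>, so the core is determined by the
  numbers \<open>c\<^sub>a\<close> of elements of \<open>B\<close> in the residue classes modulo \<open>t\<close>, and \<open>t |core| / r\<close> equals
  \<open>(t\<^sup>2 / 2r) \<Sum>\<^sub>a (c\<^sub>a - (r - a) / t)\<^sup>2\<close> up to a vanishing constant, where \<open>B\<close> is a uniform
  \<open>r\<close>-subset. The exponential of this quadratic form factors over the classes, and the constraint
  \<open>|B| = r\<close> is a Fourier coefficient: the Laplace transform of \<open>t |core| / r\<close> is a quotient of two
  integrals over \<open>u\<close> of a product of one factor per class. Each factor is a Gaussian mixture of
  binomial characteristic functions and converges to an explicit Gaussian in \<open>u\<close>; dominated
  convergence gives the Laplace transform of the Gamma distribution at every natural number. Under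
  \<open>x \<mapsto> exp (- x)\<close> this is convergence of moments on \<open>[0, 1]\<close>, hence weak convergence.
\<close>

section \<open>Beta sets\<close>

text \<open>Extension by zeros makes partitions of different lengths comparable row by row, so
  containment of diagrams becomes a pointwise inequality.\<close>

definition part :: "nat list \<Rightarrow> nat \<Rightarrow> nat" where
  "part l i = (if i < length l then l ! i else 0)"

lemma part_antimono:
  assumes "is_partition l" "i \<le> j"
  shows "part l j \<le> part l i"
  using assms unfolding is_partition_def part_def
  by (cases "i = j") (auto simp: sorted_wrt_iff_nth_less)

lemma diagram_part: "(i, j) \<in> diagram l \<longleftrightarrow> j < part l i"
  by (auto simp: diagram_def part_def)

lemma part_pos_iff:
  assumes "is_partition l"
  shows "0 < part l i \<longleftrightarrow> i < length l"
  using assms by (auto simp: is_partition_def part_def)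

lemma length_le_iff_part:
  assumes "is_partition l"
  shows "length l \<le> r \<longleftrightarrow> part l r = 0"
  using part_pos_iff[OF assms, of r] by auto

lemma part_inject:
  assumes "is_partition l" "is_partition m" "\<And>i. part l i = part m i"
  shows "l = m"
proof (rule nth_equalityI)
  have "i < length l \<longleftrightarrow> i < length m" for i
    using part_pos_iff[OF assms(1)] part_pos_iff[OF assms(2)] assms(3) by metis
  then show len: "length l = length m"
    by (meson le_antisym not_le order_refl)
  show "l ! i = m ! i" if "i < length l" for i
    using assms(3)[of i] that len by (simp add: part_def)
qed

text \<open>A weakly decreasing sequence stays zero from its first zero on, so cutting it there
  leaves exactly the positive parts. Partitions are built from prescribed row lengths in this
  way.\<close>

lemma part_exists:
  fixes f :: "nat \<Rightarrow> nat"
  assumes dec: "\<And>i. f (Suc i) \<le> f i" and "f r = 0"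
  shows "\<exists>l. is_partition l \<and> length l \<le> r \<and> part l = f"
proof -
  have anti: "f j \<le> f i" if "i \<le> j" for i j
    using that dec by (rule lift_Suc_antimono_le[rotated])
  define n where "n = (LEAST i. f i = 0)"
  have fn: "f n = 0" unfolding n_def using assms(2) by (rule LeastI)
  have pos: "0 < f i" if "i < n" for i
    using not_less_Least[of i "\<lambda>i. f i = 0"] that unfolding n_def by auto
  have "n \<le> r" unfolding n_def using assms(2) by (rule Least_le)
  have zero: "f i = 0" if "n \<le> i" for i using anti[OF that] fn by simp
  define l where "l = map f [0..<n]"
  have "is_partition l"
    unfolding is_partition_def l_def using pos anti
    by (auto simp: sorted_wrt_iff_nth_less)
  moreover have "part l = f"
    by (rule ext) (auto simp: part_def l_def zero)
  ultimately show ?thesis using \<open>n \<le> r\<close> by (auto simp: l_def)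
qed

lemma sum_list_part:
  assumes "length l \<le> r"
  shows "sum_list l = (\<Sum>i<r. part l i)"
proof -
  have "(\<Sum>i<r. part l i) = (\<Sum>i<length l. part l i)"
    using assms by (intro sum.mono_neutral_right) (auto simp: part_def)
  also have "\<dots> = (\<Sum>i<length l. l ! i)"
    by (intro sum.cong) (auto simp: part_def)
  finally show ?thesis by (simp add: sum_list_sum_nth atLeast0LessThan)
qed

lemma diagram_Sigma: "diagram l = Sigma {..<length l} (\<lambda>i. {..<l ! i})"
  by (auto simp: diagram_def)

lemma finite_diagram: "finite (diagram l)"
  by (simp add: diagram_Sigma)

lemma card_diagram: "card (diagram l) = sum_list l"
  unfolding diagram_Sigma by (subst card_SigmaI) (simp_all add: sum_list_sum_nth atLeast0LessThan)

text \<open>For \<open>i < r\<close> these are the first-column hook lengths after padding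
  \<open>l\<close> with empty rows to \<open>r\<close> rows. With \<open>r\<close> fixed, all beta
  sets have the same cardinality and can be compared along a chain of rim-hook removals.\<close>

definition beta :: "nat \<Rightarrow> nat list \<Rightarrow> nat \<Rightarrow> nat" where
  "beta r l i = part l i + (r - Suc i)"

definition beta_set :: "nat \<Rightarrow> nat list \<Rightarrow> nat set" where
  "beta_set r l = beta r l ` {..<r}"

lemma beta_strict:
  assumes "is_partition l" "i < j" "j < r"
  shows "beta r l j < beta r l i"
  using part_antimono[of l i j] assms unfolding beta_def by simp

lemma beta_less_iff:
  assumes "is_partition l" "i < r" "j < r"
  shows "beta r l j < beta r l i \<longleftrightarrow> i < j"
  using beta_strict[OF assms(1), of i j r] beta_strict[OF assms(1), of j i r] assms(2,3)
  by (cases i j rule: linorder_cases) auto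

lemma inj_on_beta:
  assumes "is_partition l"
  shows "inj_on (beta r l) {..<r}"
proof (rule inj_onI)
  fix i j assume "i \<in> {..<r}" "j \<in> {..<r}" "beta r l i = beta r l j"
  then show "i = j"
    using beta_less_iff[OF assms, of i r j] beta_less_iff[OF assms, of j r i] by simp
qed

lemma finite_beta_set: "finite (beta_set r l)"
  by (simp add: beta_set_def)

lemma card_beta_set: "is_partition l \<Longrightarrow> card (beta_set r l) = r"
  unfolding beta_set_def by (simp add: card_image inj_on_beta)

lemma sum_beta_set:
  assumes "is_partition l" "length l \<le> r"
  shows "\<Sum>(beta_set r l) = sum_list l + \<Sum>{..<r}"
proof -
  have "\<Sum>(beta_set r l) = (\<Sum>i<r. beta r l i)"
    unfolding beta_set_def using inj_on_beta[OF assms(1)] by (simp add: sum.reindex)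
  also have "\<dots> = sum_list l + (\<Sum>i<r. r - Suc i)"
    unfolding beta_def sum_list_part[OF assms(2)] by (rule sum.distrib)
  also have "(\<Sum>i<r. r - Suc i) = \<Sum>{..<r}"
    by (rule sum.nat_diff_reindex)
  finally show ?thesis .
qed

text \<open>The beta numbers strictly decrease, so the row index of an element can be recovered from
  the bare set by counting larger elements. This gives injectivity of
  \<open>beta_set\<close>.\<close>

lemma card_beta_above:
  assumes "is_partition l" "i < r"
  shows "card {b \<in> beta_set r l. beta r l i < b} = i"
proof -
  have "{b \<in> beta_set r l. beta r l i < b} = beta r l ` {..<i}"
    unfolding beta_set_def using beta_less_iff[OF assms(1) _ assms(2)] assms(2) by auto
  moreover have "inj_on (beta r l) {..<i}"
    using inj_on_beta[OF assms(1)] by (rule inj_on_subset) (use assms(2) in auto)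
  ultimately show ?thesis by (simp add: card_image)
qed

lemma beta_set_inject:
  assumes "is_partition l" "is_partition m" "length l \<le> r" "length m \<le> r"
    and eq: "beta_set r l = beta_set r m"
  shows "l = m"
proof (rule part_inject[OF assms(1,2)])
  fix i
  show "part l i = part m i"
  proof (cases "i < r")
    case True
    then have "beta r l i \<in> beta_set r m"
      using eq by (auto simp: beta_set_def)
    then obtain j where j: "j < r" "beta r l i = beta r m j"
      by (auto simp: beta_set_def)
    have "i = j"
      using card_beta_above[OF assms(1) True] card_beta_above[OF assms(2) j(1)] j(2) eq by simp
    then show ?thesis using j(2) by (simp add: beta_def)
  qed (use assms in \<open>simp add: part_def\<close>)
qed

lemma beta_set_exists:
  assumes "B \<subseteq> {..<r + s}" "card B = r"
  shows "\<exists>l\<in>box_partitions r s. beta_set r l = B"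
proof -
  have fin: "finite B" using assms(1) by (rule finite_subset) simp
  define xs where "xs = rev (sorted_list_of_set B)"
  have len: "length xs = r" and set: "set xs = B"
    using fin assms(2) by (simp_all add: xs_def)
  have sorted: "sorted_wrt (>) xs"
    by (simp add: xs_def sorted_wrt_rev)
  have dec: "xs ! j < xs ! i" if "i < j" "j < r" for i j
    using sorted_wrt_nth_less[OF sorted] that len by auto
  \<comment> \<open>Below the entry of index \<open>i\<close> there are \<open>r - Suc i\<close>
    smaller distinct entries. This keeps the truncated subtraction in the definition of
    \<open>f\<close> exact.\<close>
  have low: "r - Suc i \<le> xs ! i" if "i < r" for i
    using that
  proof (induction "r - Suc i" arbitrary: i)
    case (Suc k)
    then have "Suc i < r" "k = r - Suc (Suc i)" by auto
    then show ?case using Suc(1)[of "Suc i"] Suc(2) dec[of i "Suc i"] by simp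
  qed simp
  define f where "f i = (if i < r then xs ! i - (r - Suc i) else 0)" for i
  have "f (Suc i) \<le> f i" for i
    using dec[of i "Suc i"] low[of "Suc i"] unfolding f_def by auto
  moreover have "f r = 0" by (simp add: f_def)
  ultimately obtain l where l: "is_partition l" "length l \<le> r" "part l = f"
    using part_exists by blast
  have beta: "beta r l i = xs ! i" if "i < r" for i
    using low[OF that] that by (simp add: beta_def l(3) f_def)
  have "beta_set r l = (!) xs ` {..<r}"
    unfolding beta_set_def by (rule image_cong) (auto simp: beta)
  also have "\<dots> = B" using set len by (auto simp: set_conv_nth)
  finally have B: "beta_set r l = B" .
  have "first_part l \<le> s"
  proof (cases l)
    case (Cons x ys)
    then have "0 < r" using l(2) by simp
    then have "xs ! 0 \<in> B" using set len nth_mem[of 0 xs] by simp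
    then have "xs ! 0 < r + s" using assms(1) by auto
    moreover have "x = xs ! 0 - (r - 1)"
      using fun_cong[OF l(3), of 0] Cons \<open>0 < r\<close> by (simp add: part_def f_def)
    ultimately show ?thesis using Cons by (simp add: first_part_def)
  qed (simp add: first_part_def)
  then show ?thesis using l B by (auto simp: box_partitions_def)
qed

text \<open>The largest beta number is at most \<open>s + r - 1\<close> because rows have length at
  most \<open>s\<close>. The bijection carries the uniform law on the box to the uniform law on
  \<open>r\<close>-subsets.\<close>

lemma bij_betw_beta_set:
  "bij_betw (beta_set r) (box_partitions r s) {B. B \<subseteq> {..<r + s} \<and> card B = r}"
proof (rule bij_betw_imageI)
  show "inj_on (beta_set r) (box_partitions r s)"
    by (rule inj_onI) (auto simp: box_partitions_def intro: beta_set_inject)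
  have "beta_set r l \<subseteq> {..<r + s}" if "l \<in> box_partitions r s" for l
  proof -
    have l: "is_partition l" "first_part l \<le> s"
      using that by (auto simp: box_partitions_def)
    have le: "part l i \<le> s" for i
      using part_antimono[OF l(1), of 0 i] l(2)
      by (auto simp: part_def first_part_def split: list.splits if_splits)
    show ?thesis
    proof
      fix b assume "b \<in> beta_set r l"
      then obtain i where "i < r" "b = part l i + (r - Suc i)"
        by (auto simp: beta_set_def beta_def)
      then show "b \<in> {..<r + s}" using le[of i] by simp
    qed
  qed
  moreover have "card (beta_set r l) = r" if "l \<in> box_partitions r s" for l
    using that by (simp add: card_beta_set box_partitions_def)
  moreover have "B \<in> beta_set r ` box_partitions r s" if "B \<subseteq> {..<r + s}" "card B = r" for B
    using beta_set_exists[OF that] by blast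
  ultimately show "beta_set r ` box_partitions r s = {B. B \<subseteq> {..<r + s} \<and> card B = r}"
    by blast
qed

section \<open>Rim hooks and cores\<close>

lemma diagram_diff_iff: "(i, j) \<in> diagram l - diagram m \<longleftrightarrow> part m i \<le> j \<and> j < part l i"
  by (auto simp: diagram_part)

lemma diagram_mono_iff: "diagram m \<subseteq> diagram l \<longleftrightarrow> (\<forall>i. part m i \<le> part l i)"
proof
  assume sub: "diagram m \<subseteq> diagram l"
  show "\<forall>i. part m i \<le> part l i"
  proof
    fix i show "part m i \<le> part l i"
      using sub diagram_part[of i "part l i" m] diagram_part[of i "part l i" l]
      by (cases "part l i < part m i") auto
  qed
next
  assume "\<forall>i. part m i \<le> part l i"
  then show "diagram m \<subseteq> diagram l"
    unfolding subset_iff by (metis diagram_part less_le_trans surj_pair)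
qed

text \<open>Along a path of adjacent boxes the row changes by at most one per step, so leaving the
  rows up to \<open>k\<close> requires a vertical step, which stays in one column.\<close>

lemma boxes_connected_crossing:
  assumes "boxes_connected S" "a \<in> S" "b \<in> S" "fst a \<le> k" "k < fst b"
  shows "\<exists>j. (k, j) \<in> S \<and> (Suc k, j) \<in> S"
proof -
  have "(\<lambda>x y. x \<in> S \<and> y \<in> S \<and> box_adjacent x y)\<^sup>*\<^sup>* a b"
    using assms(1-3) by (auto simp: boxes_connected_def)
  then show ?thesis using assms(5)
  proof (induction rule: rtranclp_induct)
    case base
    then show ?case using assms(4) by simp
  next
    case (step y z)
    show ?case
    proof (cases "k < fst y")
      case False
      with step.prems step.hyps(2) have "y = (k, snd y)" "z = (Suc k, snd y)"
        by (auto simp: box_adjacent_def prod_eq_iff)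
      then show ?thesis using step.hyps(2) by metis
    qed (use step.IH in simp)
  qed
qed

text \<open>The hook occupies the rows \<open>i0\<close> to \<open>i1\<close>. By the shift
  condition the beta number of row \<open>i\<close> in \<open>m\<close> is that of row
  \<open>i + 1\<close> in \<open>l\<close>, so the numbers in between merely slide by one index:
  only the one of row \<open>i0\<close> of \<open>l\<close> is lost and only the one of row
  \<open>i1\<close> of \<open>m\<close> is gained.\<close>

lemma beta_set_hook:
  assumes "is_partition l" "i0 \<le> i1" "i1 < r"
    and out: "\<And>i. i < i0 \<or> i1 < i \<Longrightarrow> part m i = part l i"
    and shift: "\<And>i. i0 \<le> i \<Longrightarrow> i < i1 \<Longrightarrow> part l (Suc i) = Suc (part m i)"
  shows "beta_set r m = insert (beta r m i1) (beta_set r l - {beta r l i0})"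
proof -
  define A where "A = {..<i0} \<union> {i1<..<r}"
  have split: "{..<r} = insert i1 (A \<union> {i0..<i1})" "{..<r} - {i0} = A \<union> Suc ` {i0..<i1}"
    unfolding A_def using assms(2,3) by (auto simp: image_Suc_atLeastLessThan)
  have 1: "beta r m ` A = beta r l ` A"
    by (rule image_cong) (auto simp: beta_def out A_def)
  have "beta r m i = beta r l (Suc i)" if "i \<in> {i0..<i1}" for i
    using that assms(3) shift[of i] by (auto simp: beta_def)
  then have 2: "beta r m ` {i0..<i1} = beta r l ` Suc ` {i0..<i1}"
    unfolding image_image by (rule image_cong[OF refl])
  have "beta_set r l - {beta r l i0} = beta r l ` ({..<r} - {i0})"
    unfolding beta_set_def
    using inj_on_image_set_diff[OF inj_on_beta[OF assms(1)], of "{..<r}" "{i0}"] assms(2,3) by simp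
  also have "\<dots> = beta r l ` A \<union> beta r l ` Suc ` {i0..<i1}"
    unfolding split(2) by (rule image_Un)
  finally show ?thesis
    unfolding beta_set_def[of r m] split(1) image_insert image_Un 1 2 by simp
qed

lemma remove_rim_hook_length_le:
  assumes "remove_rim_hook t l m" "length l \<le> r"
  shows "length m \<le> r"
proof -
  have "part m r \<le> part l r" "is_partition l" "is_partition m"
    using assms(1) by (auto simp: remove_rim_hook_def diagram_mono_iff)
  then show ?thesis using assms(2) length_le_iff_part[of l r] length_le_iff_part[of m r] by simp
qed

lemma sum_list_rim_hook:
  assumes "remove_rim_hook t l m"
  shows "sum_list l = sum_list m + t"
proof -
  have "card (diagram l - diagram m) = card (diagram l) - card (diagram m)"
    "card (diagram m) \<le> card (diagram l)"
    using assms finite_diagram by (auto simp: remove_rim_hook_def intro: card_Diff_subset card_mono)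
  then show ?thesis using assms by (auto simp: remove_rim_hook_def card_diagram)
qed

text \<open>Connectedness makes consecutive rows of the hook share a column, and the absence of a
  square block allows only one shared column. This is the shift condition of
  \<open>beta_set_hook\<close>; comparing sizes then shows that the exchanged elements differ by
  \<open>t\<close>.\<close>

lemma remove_rim_hook_beta_set:
  assumes rh: "remove_rim_hook t l m" and len: "length l \<le> r"
  shows "\<exists>b. b + t \<in> beta_set r l \<and> beta_set r m = insert b (beta_set r l - {b + t})"
proof -
  define S where "S = diagram l - diagram m"
  have l: "is_partition l" and m: "is_partition m" and le: "part m i \<le> part l i"
    and conn: "boxes_connected S" and block: "\<not> has_2x2_block S" for i
    using rh by (auto simp: remove_rim_hook_def diagram_mono_iff S_def)
  have S: "(i, j) \<in> S \<longleftrightarrow> part m i \<le> j \<and> j < part l i" for i j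
    unfolding S_def by (rule diagram_diff_iff)
  define I where "I = {i. part m i < part l i}"
  have Ir: "I \<subseteq> {..<r}"
  proof
    fix i assume "i \<in> I"
    then have "0 < part l i" by (simp add: I_def)
    then show "i \<in> {..<r}" using len part_pos_iff[OF l] by auto
  qed
  then have fin: "finite I" by (rule finite_subset) simp
  have "S \<noteq> {}" using conn by (simp add: boxes_connected_def)
  then have ne: "I \<noteq> {}" using S by (auto simp: I_def intro: le_less_trans)
  define i0 i1 where "i0 = Min I" and "i1 = Max I"
  have mem: "i0 \<in> I" "i1 \<in> I" "i0 \<le> i1"
    using fin ne by (auto simp: i0_def i1_def)
  have out: "part m i = part l i" if "i < i0 \<or> i1 < i" for i
  proof -
    have "i \<notin> I" using that Min_le[OF fin, of i] Max_ge[OF fin, of i] by (auto simp: i0_def i1_def)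
    then show ?thesis using le[of i] by (simp add: I_def)
  qed
  have shift: "part l (Suc i) = Suc (part m i)" if i: "i0 \<le> i" "i < i1" for i
  proof -
    have "(i0, part m i0) \<in> S" "(i1, part m i1) \<in> S"
      using mem by (auto simp: S I_def)
    then obtain j where j: "(i, j) \<in> S" "(Suc i, j) \<in> S"
      using boxes_connected_crossing[OF conn, of "(i0, part m i0)" "(i1, part m i1)" i] i by auto
    then have lt: "part m i < part l (Suc i)" by (auto simp: S)
    \<comment> \<open>Otherwise the columns \<open>part m i\<close> and \<open>part m i + 1\<close>
      both belong to the two rows and form a square.\<close>
    have "\<not> Suc (part m i) < part l (Suc i)"
    proof
      assume "Suc (part m i) < part l (Suc i)"
      then have "has_2x2_block S"
        unfolding has_2x2_block_def S
        using part_antimono[OF l, of i "Suc i"] part_antimono[OF m, of i "Suc i"]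
        by (intro exI[of _ i] exI[of _ "part m i"]) simp
      then show False using block by contradiction
    qed
    then show ?thesis using lt by simp
  qed
  have r: "i1 < r" "i0 < r" using mem Ir by auto
  define x y where "x = beta r m i1" and "y = beta r l i0"
  have B: "beta_set r m = insert x (beta_set r l - {y})"
    unfolding x_def y_def using l mem(3) r(1) out shift by (rule beta_set_hook)
  have y: "y \<in> beta_set r l" using r by (simp add: y_def beta_set_def)
  \<comment> \<open>The inserted element is new, since otherwise the beta set would lose an
    element.\<close>
  have xn: "x \<notin> beta_set r l - {y}"
  proof
    assume "x \<in> beta_set r l - {y}"
    then have "beta_set r m = beta_set r l - {y}" using B by auto
    then have "card (beta_set r m) = r - 1"
      using y card_beta_set[OF l] by simp
    then show False using card_beta_set[OF m] r by simp
  qed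
  \<comment> \<open>The element sum of a beta set is the size of the partition plus a constant
    depending only on \<open>r\<close>, so \<open>y - x\<close> is the number of removed
    boxes.\<close>
  have "\<Sum>(beta_set r m) = x + (\<Sum>(beta_set r l) - y)"
    unfolding B using xn y finite_beta_set by (simp add: sum_diff1_nat)
  moreover have "y \<le> \<Sum>(beta_set r l)"
    using y finite_beta_set member_le_sum[of y "beta_set r l" "\<lambda>x. x"] by simp
  ultimately have "y = x + t"
    using sum_beta_set[OF l len] sum_beta_set[OF m remove_rim_hook_length_le[OF rh len]]
      sum_list_rim_hook[OF rh] by simp
  then show ?thesis using B y by auto
qed

text \<open>Every row is an interval connected to its left end, and the left end of row
  \<open>i\<close> lies directly above the last box of row \<open>i + 1\<close>. Hence all boxes can
  be reached from the bottom left one.\<close>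

lemma boxes_connected_hook:
  assumes S: "\<And>i j. (i, j) \<in> S \<longleftrightarrow> i0 \<le> i \<and> i \<le> i1 \<and> lo i \<le> j \<and> j < hi i"
    and ne: "\<And>i. i0 \<le> i \<Longrightarrow> i \<le> i1 \<Longrightarrow> lo i < hi i"
    and shift: "\<And>i. i0 \<le> i \<Longrightarrow> i < i1 \<Longrightarrow> hi (Suc i) = Suc (lo i)"
    and "i0 \<le> i1"
  shows "boxes_connected S"
proof -
  define R where "R = (\<lambda>x y. x \<in> S \<and> y \<in> S \<and> box_adjacent x y)"
  have sym: "symp R" by (auto simp: symp_def box_adjacent_def R_def)
  have row: "R\<^sup>*\<^sup>* (i, lo i) (i, j)" if "(i, j) \<in> S" for i j
  proof -
    have "lo i \<le> j" using that by (simp add: S)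
    then show ?thesis using that
    proof (induction j rule: dec_induct)
      case (step n)
      then have n: "(i, n) \<in> S" by (simp add: S)
      then have "R (i, n) (i, Suc n)"
        using step.prems by (simp add: R_def box_adjacent_def)
      with step.IH[OF n] show ?case by (rule rtranclp.rtrancl_into_rtrancl)
    qed simp
  qed
  have start: "R\<^sup>*\<^sup>* (i1, lo i1) (i, lo i)" if "i0 \<le> i" "i \<le> i1" for i
    using that(2,1)
  proof (induction i rule: inc_induct)
    case (step n)
    have S1: "(Suc n, lo n) \<in> S" using step.hyps step.prems shift[of n] ne[of "Suc n"] by (simp add: S)
    have S2: "(n, lo n) \<in> S" using step.hyps step.prems ne[of n] by (simp add: S)
    have "R\<^sup>*\<^sup>* (i1, lo i1) (Suc n, lo (Suc n))" using step by simp
    also have "R\<^sup>*\<^sup>* (Suc n, lo (Suc n)) (Suc n, lo n)" using S1 by (rule row)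
    also have "R (Suc n, lo n) (n, lo n)" using S1 S2 by (simp add: R_def box_adjacent_def)
    finally show ?case .
  qed simp
  have from_end: "R\<^sup>*\<^sup>* (i1, lo i1) a" if "a \<in> S" for a
  proof -
    obtain i j where a: "a = (i, j)" by fastforce
    then have "R\<^sup>*\<^sup>* (i1, lo i1) (i, lo i)" using that start[of i] by (simp add: S)
    also have "R\<^sup>*\<^sup>* (i, lo i) a" using that a row by simp
    finally show ?thesis .
  qed
  have "R\<^sup>*\<^sup>* a b" if "a \<in> S" "b \<in> S" for a b
    using from_end[OF that(2)] sympD[OF symp_rtranclp[OF sym] from_end[OF that(1)]]
    by (meson rtranclp_trans)
  moreover have "(i1, lo i1) \<in> S" using assms(4) ne[of i1] by (simp add: S)
  ultimately show ?thesis unfolding boxes_connected_def R_def by blast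
qed

text \<open>Converse of \<open>remove_rim_hook_beta_set\<close>: an element that can be lowered by
  \<open>t\<close> to a vacant position yields a hook, obtained by reversing the row description in
  \<open>beta_set_hook\<close>.\<close>

lemma remove_rim_hook_exists:
  assumes l: "is_partition l" "length l \<le> r" and "0 < t"
    and b: "b + t \<in> beta_set r l" "b \<notin> beta_set r l"
  shows "\<exists>m. remove_rim_hook t l m"
proof -
  obtain i0 where i0: "i0 < r" "b + t = beta r l i0" using b(1) by (auto simp: beta_set_def)
  \<comment> \<open>Rows whose beta number exceeds the vacant position \<open>b\<close>. After the
    exchange \<open>b\<close> takes the place of the last of them, so that is the row where the hook
    ends.\<close>
  define J where "J = {i. i < r \<and> b < beta r l i}"
  have fin: "finite J" and i0J: "i0 \<in> J" using i0 assms(3) by (auto simp: J_def)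
  define i1 where "i1 = Max J"
  have i1J: "i1 \<in> J" unfolding i1_def using fin i0J by (intro Max_in) auto
  have le: "i0 \<le> i1" unfolding i1_def using fin i0J by simp
  have i1: "i1 < r" "b < beta r l i1" using i1J by (auto simp: J_def)
  have next_less: "beta r l (Suc i1) < b" if "Suc i1 < r"
  proof -
    have "Suc i1 \<notin> J" using Max_ge[OF fin, of "Suc i1"] by (auto simp: i1_def)
    then show ?thesis using that b(2) by (auto simp: J_def beta_set_def intro: le_neq_implies_less)
  qed
  have low: "r - Suc i1 \<le> b"
    using next_less i1(1) unfolding beta_def by (cases "Suc i1 < r") auto
  \<comment> \<open>The new row lengths are forced: row \<open>i1\<close> must receive the beta
    number \<open>b\<close>, and every hook row above it must be one shorter than the next row of
    \<open>l\<close>.\<close>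
  define f where "f i = (if i < i0 \<or> i1 < i then part l i
    else if i = i1 then b - (r - Suc i1) else part l (Suc i) - 1)" for i
  have end_lt: "f i1 < part l i1"
    using le i1(2) low unfolding f_def beta_def by simp
  have end_ge: "part l (Suc i1) \<le> f i1"
    using le next_less low l part_pos_iff[OF l(1), of "Suc i1"] unfolding f_def beta_def
    by (cases "Suc i1 < r") auto
  have anti: "part l (Suc i) \<le> part l i" for i
    using part_antimono[OF l(1), of i "Suc i"] by simp
  have pos: "0 < part l i" if "i \<le> i1" for i
    using part_antimono[OF l(1) that] end_lt by simp
  have fle: "f i \<le> part l i" for i
    using anti[of i] end_lt unfolding f_def by (auto split: if_splits)
  have shift: "part l (Suc i) = Suc (f i)" if "i0 \<le> i" "i < i1" for i
    using that pos[of "Suc i"] by (simp add: f_def)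
  have lt: "f i < part l i" if "i0 \<le> i" "i \<le> i1" for i
    using that shift[of i] anti[of i] end_lt by (cases "i = i1") auto
  have dec: "f (Suc i) \<le> f i" for i
  proof -
    consider "i < i0" | "i0 \<le> i" "i < i1" | "i = i1" | "i1 < i" by linarith
    then show ?thesis
    proof cases
      case 1
      then show ?thesis using fle[of "Suc i"] anti[of i] by (simp add: f_def)
    next
      case 2
      then show ?thesis using lt[of "Suc i"] shift[of i] by simp
    next
      case 3
      then show ?thesis using end_ge by (simp add: f_def)
    next
      case 4
      then show ?thesis using anti[of i] le by (simp add: f_def)
    qed
  qed
  have "f r = 0" using i1(1) l by (simp add: f_def length_le_iff_part)
  from part_exists[of f, OF dec this] obtain m
    where m: "is_partition m" "length m \<le> r" "part m = f" by blast
  have out: "part m i = part l i" if "i < i0 \<or> i1 < i" for i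
    using that by (simp add: m(3) f_def)
  have sub: "diagram m \<subseteq> diagram l" using fle by (simp add: diagram_mono_iff m(3))
  define S where "S = diagram l - diagram m"
  have S: "(i, j) \<in> S \<longleftrightarrow> i0 \<le> i \<and> i \<le> i1 \<and> f i \<le> j \<and> j < part l i" for i j
    unfolding S_def diagram_diff_iff using out[of i] m(3)
    by (cases "i < i0 \<or> i1 < i") auto
  have conn: "boxes_connected S"
    using S lt shift le by (rule boxes_connected_hook)
  have block: "\<not> has_2x2_block S"
    using shift by (fastforce simp: has_2x2_block_def S)
  have "beta r m i1 = b" using low le by (simp add: beta_def m(3) f_def)
  then have B: "beta_set r m = insert b (beta_set r l - {b + t})"
    using beta_set_hook[OF l(1) le i1(1), of m] out shift i0(2) m(3) by simp
  have "\<Sum>(beta_set r m) = b + (\<Sum>(beta_set r l) - (b + t))"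
    unfolding B using b finite_beta_set by (simp add: sum_diff1_nat)
  moreover have "b + t \<le> \<Sum>(beta_set r l)"
    using b(1) finite_beta_set member_le_sum[of "b + t" "beta_set r l" "\<lambda>x. x"] by simp
  ultimately have "sum_list l = sum_list m + t"
    using sum_beta_set[OF l] sum_beta_set[OF m(1,2)] by simp
  then have "card S = t"
    unfolding S_def using card_Diff_subset[OF finite_diagram sub] by (simp add: card_diagram)
  then show ?thesis
    using l(1) m(1) sub conn block by (auto simp: remove_rim_hook_def S_def)
qed

section \<open>Residue counts as the invariants that determine the core\<close>

definition residue_count :: "nat \<Rightarrow> nat set \<Rightarrow> nat \<Rightarrow> nat" where
  "residue_count t B a = card {b \<in> B. b mod t = a}"

text \<open>The exchanged elements \<open>b + t\<close> and \<open>b\<close> lie in the same residue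
  class, and equality of cardinalities shows that \<open>b\<close> was vacant. On an abacus with
  \<open>t\<close> runners, a bead slides down one place on its own runner.\<close>

lemma residue_count_rim_hook:
  assumes rh: "remove_rim_hook t l m" and len: "length l \<le> r"
  shows "residue_count t (beta_set r m) a = residue_count t (beta_set r l) a"
proof -
  have part: "is_partition l" "is_partition m" using rh by (auto simp: remove_rim_hook_def)
  obtain b where b: "b + t \<in> beta_set r l" "beta_set r m = insert b (beta_set r l - {b + t})"
    using remove_rim_hook_beta_set[OF assms] by blast
  have "b \<notin> beta_set r l - {b + t}"
  proof
    assume "b \<in> beta_set r l - {b + t}"
    then have "beta_set r m = beta_set r l - {b + t}" using b by auto
    then have "card (beta_set r l) = Suc (card (beta_set r m))"
      using b(1) finite_beta_set[of r l] by (metis card_Suc_Diff1)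
    then show False using part by (simp add: card_beta_set)
  qed
  define C where "C = {x \<in> beta_set r l - {b + t}. x mod t = a}"
  have C: "finite C" "b + t \<notin> C" "b \<notin> C"
    using finite_beta_set[of r l] \<open>b \<notin> _\<close> by (auto simp: C_def)
  have "{x \<in> beta_set r l. x mod t = a} = (if b mod t = a then insert (b + t) C else C)"
    using b(1) by (auto simp: C_def)
  moreover have "{x \<in> beta_set r m. x mod t = a} = (if b mod t = a then insert b C else C)"
    by (auto simp: C_def b(2))
  ultimately show ?thesis using C by (simp add: residue_count_def)
qed

text \<open>On each runner of the abacus the occupied levels form a finite downward closed set,
  hence an initial segment. A set closed under subtracting \<open>t\<close> is therefore determined
  by its residue counts.\<close>

lemma closed_eq_progressions:
  assumes "finite B" "a < t" and closed: "\<And>b. b + t \<in> B \<Longrightarrow> b \<in> B"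
  shows "{b \<in> B. b mod t = a} = (\<lambda>k. a + t * k) ` {..<residue_count t B a}"
proof -
  define K where "K = {k. a + t * k \<in> B}"
  have inj: "inj (\<lambda>k. a + t * k)" using assms(2) by (auto simp: inj_on_def)
  have img: "{b \<in> B. b mod t = a} = (\<lambda>k. a + t * k) ` K"
  proof (intro equalityI subsetI)
    fix b assume b: "b \<in> {b \<in> B. b mod t = a}"
    then have "b = a + t * (b div t)" by (metis (mono_tags, lifting) mem_Collect_eq mod_mult_div_eq)
    then show "b \<in> (\<lambda>k. a + t * k) ` K" using b by (auto simp: K_def)
  qed (use assms(2) in \<open>auto simp: K_def\<close>)
  have finK: "finite K"
  proof (rule finite_imageD)
    show "finite ((\<lambda>k. a + t * k) ` K)" unfolding img[symmetric] using assms(1) by simp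
    show "inj_on (\<lambda>k. a + t * k) K" using inj by (rule inj_on_subset) simp
  qed
  have down: "k \<in> K" if "Suc k \<in> K" for k
    using closed[of "a + t * k"] that by (simp add: K_def ac_simps)
  have down': "j \<in> K" if "j \<le> k" "k \<in> K" for j k
    using that by (induction rule: inc_induct) (auto intro: down)
  have "K = {..<card K}"
  proof (cases "K = {}")
    case False
    have "\<exists>M. K = {..M}"
    proof (intro exI equalityI subsetI)
      show "k \<in> {..Max K}" if "k \<in> K" for k using finK that by simp
      show "k \<in> K" if "k \<in> {..Max K}" for k
        using down'[OF _ Max_in[OF finK False]] that by simp
    qed
    then obtain M where "K = {..M}" ..
    then show ?thesis by (simp add: lessThan_Suc_atMost)
  qed simp
  moreover have "residue_count t B a = card K"
    unfolding residue_count_def img using inj by (simp add: card_image inj_on_subset)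
  ultimately show ?thesis using img by simp
qed

text \<open>Each removal decreases the size, so a terminal partition exists. Its beta set is closed
  under subtracting \<open>t\<close> and has the residue counts of \<open>l\<close>, which
  determines it; thus the description defining \<open>core\<close> denotes.\<close>

lemma core_properties:
  assumes "is_partition l" "length l \<le> r" "0 < t"
  shows "is_partition (core t l)" "length (core t l) \<le> r"
    "\<And>b. b + t \<in> beta_set r (core t l) \<Longrightarrow> b \<in> beta_set r (core t l)"
    "residue_count t (beta_set r (core t l)) = residue_count t (beta_set r l)"
proof -
  define P where "P m \<longleftrightarrow> is_partition m \<and> length m \<le> r \<and>
    residue_count t (beta_set r m) = residue_count t (beta_set r l)" for m
  let ?T = "\<lambda>m. (remove_rim_hook t)\<^sup>*\<^sup>* l m \<and> (\<nexists>m'. remove_rim_hook t m m')"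
  have step: "P m'" if "P m" "remove_rim_hook t m m'" for m m'
  proof -
    have len: "length m \<le> r" using that(1) by (simp add: P_def)
    have "residue_count t (beta_set r m') = residue_count t (beta_set r m)"
      using residue_count_rim_hook[OF that(2) len] by (rule ext)
    then show ?thesis
      using that(1) remove_rim_hook_length_le[OF that(2) len] that(2)[unfolded remove_rim_hook_def]
      by (simp add: P_def)
  qed
  have reach: "P m" if "(remove_rim_hook t)\<^sup>*\<^sup>* l m" for m
    using that
  proof induction
    case base
    then show ?case using assms by (simp add: P_def)
  next
    case (step m m')
    then show ?case using \<open>\<And>m m'. P m \<Longrightarrow> remove_rim_hook t m m' \<Longrightarrow> P m'\<close> by blast
  qed
  have closed: "b \<in> beta_set r m" if "P m" "\<nexists>m'. remove_rim_hook t m m'" "b + t \<in> beta_set r m" for m b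
    using remove_rim_hook_exists[of m r t b] that assms(3) by (auto simp: P_def)
  have ex: "\<exists>m'. (remove_rim_hook t)\<^sup>*\<^sup>* m m' \<and> (\<nexists>m''. remove_rim_hook t m' m'')" for m
  proof (induction "sum_list m" arbitrary: m rule: less_induct)
    case less
    show ?case
    proof (cases "\<exists>m'. remove_rim_hook t m m'")
      case True
      then obtain m' where m': "remove_rim_hook t m m'" by blast
      then have "sum_list m' < sum_list m" using sum_list_rim_hook assms(3) by fastforce
      from less[OF this] m' show ?thesis by (meson converse_rtranclp_into_rtranclp)
    qed blast
  qed
  have prog: "{b \<in> beta_set r m. b mod t = a} =
      (\<lambda>k. a + t * k) ` {..<residue_count t (beta_set r l) a}" if m: "?T m" and a: "a < t" for m a
  proof -
    have "P m" using m reach by blast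
    moreover have "b \<in> beta_set r m" if "b + t \<in> beta_set r m" for b
      using closed[OF \<open>P m\<close> _ that] m by blast
    ultimately show ?thesis
      using closed_eq_progressions[OF finite_beta_set a, of r m] by (simp add: P_def)
  qed
  have unique: "m = m'" if m: "?T m" and m': "?T m'" for m m'
  proof -
    have P: "P m" "P m'" using reach m m' by blast+
    have "{b \<in> beta_set r m. b mod t = a} = {b \<in> beta_set r m'. b mod t = a}" if "a < t" for a
      unfolding prog[OF m that] prog[OF m' that] ..
    from this[of "b mod t" for b] have "b \<in> beta_set r m \<longleftrightarrow> b \<in> beta_set r m'" for b
      using assms(3) by auto
    then have "beta_set r m = beta_set r m'" by blast
    then show ?thesis using P by (auto simp: P_def intro: beta_set_inject)
  qed
  \<comment> \<open>Unique existence is what permits unfolding the definite description in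
    \<open>core\<close>.\<close>
  have "\<exists>!m. ?T m" using ex[of l] unique by blast
  then have T: "?T (core t l)" unfolding core_def by (rule theI')
  then have P: "P (core t l)" using reach by blast
  then show "is_partition (core t l)" "length (core t l) \<le> r"
    "residue_count t (beta_set r (core t l)) = residue_count t (beta_set r l)"
    by (simp_all add: P_def)
  show "b \<in> beta_set r (core t l)" if "b + t \<in> beta_set r (core t l)" for b
    using closed[OF P _ that] T by blast
qed

section \<open>The size of the core as a quadratic form in the residue counts\<close>

lemma sum_residue_count:
  assumes "finite B" "0 < t"
  shows "(\<Sum>a<t. residue_count t B a) = card B"
proof -
  have "(\<Sum>a<t. \<Sum>b\<in>{b \<in> B. b mod t = a}. 1) = (\<Sum>b\<in>B. 1::nat)"
    using assms by (intro sum.group) auto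
  then show ?thesis by (simp add: residue_count_def)
qed

lemma size_core:
  assumes "is_partition l" "length l \<le> r" "0 < t"
  shows "sum_list (core t l) + \<Sum>{..<r} =
    (\<Sum>a<t. \<Sum>k<residue_count t (beta_set r l) a. a + t * k)"
proof -
  note core = core_properties[OF assms]
  define B where "B = beta_set r (core t l)"
  have fin: "finite B" by (simp add: B_def finite_beta_set)
  have "\<Sum>B = (\<Sum>a<t. \<Sum>{b \<in> B. b mod t = a})"
    using assms(3) fin by (intro sum.group[symmetric]) auto
  also have "\<dots> = (\<Sum>a<t. \<Sum>k<residue_count t B a. a + t * k)"
  proof (rule sum.cong)
    fix a assume "a \<in> {..<t}"
    then have "a < t" by simp
    then have "{b \<in> B. b mod t = a} = (\<lambda>k. a + t * k) ` {..<residue_count t B a}"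
      using closed_eq_progressions[OF fin, of a t] core(3) by (auto simp: B_def)
    then show "\<Sum>{b \<in> B. b mod t = a} = (\<Sum>k<residue_count t B a. a + t * k)"
      using assms(3) by (simp add: sum.reindex inj_on_def)
  qed simp
  finally show ?thesis
    using sum_beta_set[OF core(1,2)] core(4) by (simp add: B_def)
qed

lemma sum_arithmetic_progression: "(\<Sum>k<c. real (a + t * k)) = real t / 2 * real c ^ 2 + (real a - real t / 2) * real c"
  by (induction c) (simp_all add: field_simps power2_eq_square)

text \<open>Completing the square absorbs the linear term in the residue counts.\<close>

lemma scaled_size_core:
  assumes "is_partition l" "length l \<le> r" "0 < t"
  shows "real t * real (sum_list (core t l)) =
    real t ^ 2 / 2 * (\<Sum>a<t. (real (residue_count t (beta_set r l) a) - (real r - real a) / real t) ^ 2)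
    - (\<Sum>a<t. real a ^ 2) / 2"
proof -
  let ?c = "\<lambda>a. real (residue_count t (beta_set r l) a)"
  have tot: "(\<Sum>a<t. ?c a) = real r"
    using sum_residue_count[OF finite_beta_set assms(3), of r l] card_beta_set[OF assms(1), of r]
    by (metis of_nat_sum)
  have gauss: "(\<Sum>i<n. real i) = real n * (real n - 1) / 2" for n
    by (induction n) (simp_all add: field_simps)
  have "real (sum_list (core t l)) + (\<Sum>i<r. real i) = (\<Sum>a<t. \<Sum>k<residue_count t (beta_set r l) a. real (a + t * k))"
    using arg_cong[OF size_core[OF assms], of real] by simp
  also have "\<dots> = (\<Sum>a<t. real t / 2 * ?c a ^ 2 + (real a - real t / 2) * ?c a)"
    by (simp only: sum_arithmetic_progression)
  finally have size: "real (sum_list (core t l)) =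
      (\<Sum>a<t. real t / 2 * ?c a ^ 2 + (real a - real t / 2) * ?c a) - real r * (real r - 1) / 2"
    by (simp add: gauss)
  \<comment> \<open>The centres \<open>(r - a) / t\<close> are chosen so that the surplus linear
    coefficient \<open>t^2 / 2 - r t\<close> is the same for every class; it then meets only the
    total \<open>r\<close> of the counts.\<close>
  have "(real t)^2 / 2 * (\<Sum>a<t. (?c a - (real r - real a) / real t) ^ 2) =
    (\<Sum>a<t. real t * (real t / 2 * ?c a ^ 2 + (real a - real t / 2) * ?c a)
      + ((real t)^2 / 2 - real r * real t) * ?c a + (real r ^ 2 / 2 - real r * real a + real a ^ 2 / 2))"
    unfolding sum_distrib_left using assms(3)
    by (intro sum.cong) (simp_all add: field_simps power2_eq_square)
  also have "\<dots> = real t * (\<Sum>a<t. real t / 2 * ?c a ^ 2 + (real a - real t / 2) * ?c a)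
      + ((real t)^2 / 2 - real r * real t) * real r
      + (real t * (real r ^ 2 / 2) - real r * (real t * (real t - 1) / 2) + (\<Sum>a<t. real a ^ 2) / 2)"
    by (simp add: sum.distrib sum_subtractf sum_distrib_left[symmetric] sum_divide_distrib[symmetric] tot gauss)
  finally show ?thesis
    unfolding size by (simp add: field_simps power2_eq_square)
qed

section \<open>Laplace transforms and the Gamma distribution\<close>

text \<open>With \<open>v = exp (- u)\<close> the hypotheses say that all moments of a variable in
  [0, 1] converge. Bernstein polynomials in \<open>v\<close> approximate the test functions
  \<open>cts_step\<close> uniformly there, so an e/3 argument transfers the convergence to
  them.\<close>

lemma weak_conv_m_laplace:
  fixes M :: "nat \<Rightarrow> real measure"
  assumes M: "\<And>n. real_distribution (M n)" and N: "real_distribution N"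
    and pos: "\<And>n. AE x in M n. 0 \<le> x" "AE x in N. 0 \<le> x"
    and conv: "\<And>k::nat. (\<lambda>n. \<integral>x. exp (- (real k * x)) \<partial>M n) \<longlonglongrightarrow> (\<integral>x. exp (- (real k * x)) \<partial>N)"
  shows "weak_conv_m M N"
proof (rule integral_cts_step_conv_imp_weak_conv[OF M N])
  fix x y :: real
  assume xy: "x < y"
  define v where "v u = exp (- u)" for u :: real
  have int: "integrable D (\<lambda>u. v u ^ k * (1 - v u) ^ m)"
    if D: "real_distribution D" "AE u in D. 0 \<le> u" for D :: "real measure" and k m
  proof -
    interpret real_distribution D by fact
    show ?thesis
    proof (rule integrable_const_bound[where B = 1])
      show "AE u in D. norm (v u ^ k * (1 - v u) ^ m) \<le> 1"
        using D(2)
      proof eventually_elim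
        case (elim u)
        then have "0 \<le> v u" "v u \<le> 1" by (auto simp: v_def)
        then show ?case by (auto simp: abs_mult power_abs intro!: mult_le_one power_le_one)
      qed
    qed (simp add: v_def)
  qed
  \<comment> \<open>Bernstein polynomials involve mixed powers; each factor \<open>1 - v\<close> is
    removed at the price of a difference of two integrals with a lower exponent.\<close>
  have mixed: "(\<lambda>n. \<integral>u. v u ^ k * (1 - v u) ^ m \<partial>M n) \<longlonglongrightarrow> (\<integral>u. v u ^ k * (1 - v u) ^ m \<partial>N)" for k m
  proof (induction m arbitrary: k)
    case 0
    then show ?case using conv[of k] by (simp add: v_def exp_of_nat_mult[symmetric])
  next
    case (Suc m)
    have split: "(\<integral>u. v u ^ k * (1 - v u) ^ Suc m \<partial>D) =
      (\<integral>u. v u ^ k * (1 - v u) ^ m \<partial>D) - (\<integral>u. v u ^ Suc k * (1 - v u) ^ m \<partial>D)"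
      if "real_distribution D" "AE u in D. 0 \<le> u" for D
      unfolding Bochner_Integration.integral_diff[OF int[OF that] int[OF that], symmetric]
      by (intro Bochner_Integration.integral_cong) (simp_all add: algebra_simps)
    show ?case
      unfolding split[OF M pos(1)] split[OF N pos(2)] by (intro tendsto_diff Suc)
  qed
  \<comment> \<open>This is \<open>cts_step\<close> as a function of \<open>v\<close>, with
    \<open>u = - ln v\<close>. Truncating the logarithm at \<open>exp (- y)\<close> keeps it
    continuous at 0, the image of infinity, without changing the value, since the step vanishes
    beyond \<open>y\<close>.\<close>
  define f where "f w = min 1 (max 0 ((y + ln (max w (exp (- y)))) / (y - x)))" for w
  have f: "f (v u) = cts_step x y u" for u
    using xy by (auto simp: f_def v_def cts_step_def max_def min_def field_simps)
  have "max w (exp (- y)) \<noteq> 0" for w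
    using exp_gt_zero[of "- y"] by (auto simp: max_def)
  then have "continuous_on {0..1} f"
    unfolding f_def by (intro continuous_intros) (use xy in simp_all)
  then have bern: "\<exists>n. \<forall>w\<in>{0..1}. \<bar>f w - (\<Sum>k\<le>n. f (k / n) * Bernstein n k w)\<bar> < e" if "0 < e" for e
    using Bernstein_Weierstrass[of f e] that by blast
  show "(\<lambda>n. integral\<^sup>L (M n) (cts_step x y)) \<longlonglongrightarrow> integral\<^sup>L N (cts_step x y)"
  proof (rule LIMSEQ_I)
    fix e :: real assume "0 < e"
    then have "0 < e / 3" by simp
    from bern[OF this] obtain d
      where d: "\<forall>w\<in>{0..1}. \<bar>f w - (\<Sum>k\<le>d. f (k / d) * Bernstein d k w)\<bar> < e / 3" ..
    define P where "P w = (\<Sum>k\<le>d. f (k / d) * Bernstein d k w)" for w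
    have P: "P (v u) = (\<Sum>k\<le>d. (f (k / d) * real (d choose k)) * (v u ^ k * (1 - v u) ^ (d - k)))" for u
      by (simp add: P_def Bernstein_def mult.assoc)
    have intP: "integrable D (\<lambda>u. P (v u))"
      and appr: "\<bar>integral\<^sup>L D (cts_step x y) - (\<integral>u. P (v u) \<partial>D)\<bar> \<le> e / 3"
      if D: "real_distribution D" "AE u in D. 0 \<le> u" for D
    proof -
      interpret real_distribution D by fact
      show intP: "integrable D (\<lambda>u. P (v u))"
        unfolding P using int[OF D] by (intro Bochner_Integration.integrable_sum integrable_mult_right)
      have "\<bar>\<integral>u. cts_step x y u - P (v u) \<partial>D\<bar> \<le> (\<integral>u. \<bar>cts_step x y u - P (v u)\<bar> \<partial>D)"
        by (rule integral_abs_bound)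
      also have "\<dots> \<le> (\<integral>u. e / 3 \<partial>D)"
      proof (rule integral_mono_AE)
        show "AE u in D. \<bar>cts_step x y u - P (v u)\<bar> \<le> e / 3"
          using D(2)
        proof eventually_elim
          case (elim u)
          then show ?case using bspec[OF d, of "v u"] f[of u] by (simp add: P_def v_def less_imp_le)
        qed
      qed (use intP integrable_cts_step[OF xy] in auto)
      finally show "\<bar>integral\<^sup>L D (cts_step x y) - (\<integral>u. P (v u) \<partial>D)\<bar> \<le> e / 3"
        using intP integrable_cts_step[OF xy] prob_space by simp
    qed
    have eq: "(\<integral>u. P (v u) \<partial>D) = (\<Sum>k\<le>d. (f (k / d) * real (d choose k)) * (\<integral>u. v u ^ k * (1 - v u) ^ (d - k) \<partial>D))"
      if D: "real_distribution D" "AE u in D. 0 \<le> u" for D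
      unfolding P using int[OF D] by (subst Bochner_Integration.integral_sum) auto
    have "(\<lambda>n. \<integral>u. P (v u) \<partial>M n) \<longlonglongrightarrow> (\<integral>u. P (v u) \<partial>N)"
      unfolding eq[OF M pos(1)] eq[OF N pos(2)] by (intro tendsto_sum tendsto_mult tendsto_const mixed)
    then obtain n0 where n0: "\<And>n. n0 \<le> n \<Longrightarrow> \<bar>(\<integral>u. P (v u) \<partial>M n) - (\<integral>u. P (v u) \<partial>N)\<bar> < e / 3"
      using LIMSEQ_D[of _ _ "e / 3"] \<open>0 < e\<close> by (metis real_norm_def zero_less_divide_iff zero_less_numeral)
    have "norm (integral\<^sup>L (M n) (cts_step x y) - integral\<^sup>L N (cts_step x y)) < e" if "n0 \<le> n" for n
      using n0[OF that] appr[OF M pos(1), of n] appr[OF N pos(2)] unfolding real_norm_def by linarith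
    then show "\<exists>n0. \<forall>n\<ge>n0. norm (integral\<^sup>L (M n) (cts_step x y) - integral\<^sup>L N (cts_step x y)) < e"
      by blast
  qed
qed

section \<open>Normalisation and Laplace transform of the Gamma distribution\<close>

lemma gamma_density_nonneg: "0 < \<alpha> \<Longrightarrow> 0 \<le> gamma_density \<alpha> \<beta> x"
  by (simp add: gamma_density_def Gamma_real_pos less_imp_le)

lemma borel_measurable_gamma_density [measurable]: "gamma_density \<alpha> \<beta> \<in> borel_measurable borel"
  unfolding gamma_density_def[abs_def] by measurable

lemma nn_integral_gamma_density:
  assumes "0 < \<alpha>" "0 < \<beta>"
  shows "(\<integral>\<^sup>+x. gamma_density \<alpha> \<beta> x \<partial>lborel) = 1"
proof -
  have G: "0 < Gamma \<alpha>" using assms(1) by (rule Gamma_real_pos)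
  have "ennreal (Gamma \<alpha>) = (\<integral>\<^sup>+x. ennreal (indicator {0..} x * x powr (\<alpha> - 1) / exp x) \<partial>lborel)"
    by (rule Gamma_conv_nn_integral_real) fact
  also have "\<dots> = ennreal \<bar>\<beta>\<bar> * (\<integral>\<^sup>+x. ennreal (indicator {0..} (0 + \<beta> * x) * (0 + \<beta> * x) powr (\<alpha> - 1) / exp (0 + \<beta> * x)) \<partial>lborel)"
    using assms(2) by (intro nn_integral_real_affine) auto
  also have "\<dots> = (\<integral>\<^sup>+x. ennreal (Gamma \<alpha>) * ennreal (gamma_density \<alpha> \<beta> x) \<partial>lborel)"
  proof (subst nn_integral_cmult[symmetric]; (intro nn_integral_cong)?)
    fix x :: real
    show "ennreal \<bar>\<beta>\<bar> * ennreal (indicator {0..} (0 + \<beta> * x) * (0 + \<beta> * x) powr (\<alpha> - 1) / exp (0 + \<beta> * x))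
      = ennreal (Gamma \<alpha>) * ennreal (gamma_density \<alpha> \<beta> x)"
    proof (cases "0 < x")
      case True
      have "\<beta> * \<beta> powr (\<alpha> - 1) = \<beta> powr \<alpha>" using assms(2) by (simp add: powr_diff)
      then show ?thesis
        using True G assms less_imp_neq[OF G]
        by (simp add: gamma_density_def ennreal_mult[symmetric] powr_mult exp_minus field_simps)
    next
      case False
      then show ?thesis using assms(2)
        by (cases "x = 0") (auto simp: gamma_density_def indicator_def zero_le_mult_iff)
    qed
  qed measurable
  also have "\<dots> = ennreal (Gamma \<alpha>) * (\<integral>\<^sup>+x. gamma_density \<alpha> \<beta> x \<partial>lborel)"
    by (rule nn_integral_cmult) simp
  finally show ?thesis
    using G by (metis ennreal_mult_cancel_left mult.right_neutral ennreal_neq_top ennreal_eq_0_iff not_le)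
qed

lemma real_distribution_gamma:
  assumes "0 < \<alpha>" "0 < \<beta>"
  shows "real_distribution (gamma_distribution \<alpha> \<beta>)"
proof -
  have "prob_space (gamma_distribution \<alpha> \<beta>)"
    by (rule prob_spaceI) (simp add: gamma_distribution_def emeasure_density nn_integral_gamma_density[OF assms])
  then show ?thesis
    by (simp add: real_distribution_def real_distribution_axioms_def gamma_distribution_def)
qed

lemma AE_gamma_nonneg: "AE x in gamma_distribution \<alpha> \<beta>. 0 \<le> x"
  unfolding gamma_distribution_def
  by (subst AE_density) (auto simp: gamma_density_def)

text \<open>Multiplication by \<open>exp (- (k * x))\<close> only raises the rate from
  \<open>\<beta>\<close> to \<open>\<beta> + k\<close>; the transform is the quotient of the two
  normalising constants.\<close>

lemma laplace_gamma:
  assumes "0 < \<alpha>" "0 < \<beta>" "0 \<le> k"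
  shows "(\<integral>x. exp (- (k * x)) \<partial>gamma_distribution \<alpha> \<beta>) = (\<beta> / (\<beta> + k)) powr \<alpha>"
proof -
  have bk: "0 < \<beta> + k" using assms by simp
  have "(\<integral>x. gamma_density \<alpha> (\<beta> + k) x \<partial>lborel) = 1"
    using nn_integral_gamma_density[OF assms(1) bk] gamma_density_nonneg[OF assms(1)]
    by (subst integral_eq_nn_integral) auto
  moreover have "gamma_density \<alpha> \<beta> x * exp (- (k * x)) = (\<beta> / (\<beta> + k)) powr \<alpha> * gamma_density \<alpha> (\<beta> + k) x" for x
  proof -
    have e: "exp ((- \<beta> - k) * x) = exp (- (\<beta> * x)) * exp (- (k * x))"
      by (simp add: exp_add[symmetric] algebra_simps)
    show ?thesis using assms(2) bk by (simp add: gamma_density_def powr_divide e)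
  qed
  ultimately show ?thesis
    using gamma_density_nonneg[OF assms(1)]
    by (simp add: gamma_distribution_def integral_density)
qed

section \<open>Gaussian mixtures of binomial characteristic functions\<close>

interpretation std_normal: real_distribution std_normal_distribution
  by (rule real_dist_normal_dist)

lemma integral_cis_std_normal: "(CLINT g|std_normal_distribution. cis (x * g)) = of_real (exp (- x\<^sup>2 / 2))"
  using fun_cong[OF char_std_normal_distribution, of x] by (simp add: char_def cis_conv_exp)

lemma measurable_cis [measurable]: "cis \<in> borel_measurable borel"
  by (intro borel_measurable_continuous_onI continuous_intros)

text \<open>For \<open>p\<close> in [0, 1] this is the characteristic function of a binomial count,
  damped by a Gaussian weight. The centres \<open>m\<close> of the weight and \<open>d\<close> of
  the phase are separate because they will be \<open>(r - a) / t\<close> and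
  \<open>r / t\<close>.\<close>

definition smoothed_char :: "nat \<Rightarrow> real \<Rightarrow> real \<Rightarrow> real \<Rightarrow> real \<Rightarrow> real \<Rightarrow> complex" where
  "smoothed_char n p \<tau> m d \<phi> = (\<Sum>c\<le>n. of_real (real (n choose c) * (p ^ c * (1 - p) ^ (n - c)) *
     exp (- (\<tau> * (real c - m))\<^sup>2 / 2)) * cis (\<phi> * (real c - d)))"

lemma measurable_smoothed_char [measurable]: "smoothed_char n p \<tau> m d \<in> borel_measurable borel"
  unfolding smoothed_char_def[abs_def] by measurable

text \<open>The Gaussian weight is itself a characteristic function, which turns the binomial sum into
  a Gaussian mixture of binomial characteristic functions.\<close>

lemma smoothed_char_mixture:
  "smoothed_char n p \<tau> m d \<phi> = (CLINT g|std_normal_distribution.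
     (of_real (1 - p) + of_real p * cis (\<phi> + \<tau> * g)) ^ n * cis (- (\<tau> * g * m + \<phi> * d)))"
proof -
  let ?b = "\<lambda>c. of_real (real (n choose c) * (p ^ c * (1 - p) ^ (n - c))) * cis (\<phi> * (real c - d)) :: complex"
  have int: "integrable std_normal_distribution (\<lambda>g. ?b c * cis (\<tau> * (real c - m) * g))" for c
    by (intro integrable_mult_right std_normal.integrable_const_bound[where B = 1]) auto
  have "smoothed_char n p \<tau> m d \<phi> = (\<Sum>c\<le>n. ?b c * (CLINT g|std_normal_distribution. cis (\<tau> * (real c - m) * g)))"
    unfolding smoothed_char_def by (intro sum.cong) (simp_all add: integral_cis_std_normal)
  also have "\<dots> = (CLINT g|std_normal_distribution. \<Sum>c\<le>n. ?b c * cis (\<tau> * (real c - m) * g))"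
    using int by (subst Bochner_Integration.integral_sum) auto
  also have "\<dots> = (CLINT g|std_normal_distribution.
     (of_real (1 - p) + of_real p * cis (\<phi> + \<tau> * g)) ^ n * cis (- (\<tau> * g * m + \<phi> * d)))"
  proof (intro Bochner_Integration.integral_cong)
    fix g
    have bin: "(of_real (1 - p) + of_real p * cis (\<phi> + \<tau> * g)) ^ n =
      (\<Sum>c\<le>n. of_nat (n choose c) * (of_real p * cis (\<phi> + \<tau> * g)) ^ c * of_real (1 - p) ^ (n - c))"
      unfolding add.commute[of "of_real (1 - p)"] by (rule binomial_ring)
    show "(\<Sum>c\<le>n. ?b c * cis (\<tau> * (real c - m) * g)) =
      (of_real (1 - p) + of_real p * cis (\<phi> + \<tau> * g)) ^ n * cis (- (\<tau> * g * m + \<phi> * d))"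
      unfolding bin sum_distrib_right
    proof (intro sum.cong refl)
      fix c
      have "cis (\<phi> + \<tau> * g) ^ c * cis (- (\<tau> * g * m + \<phi> * d)) = cis (\<phi> * (real c - d)) * cis (\<tau> * (real c - m) * g)"
        unfolding Complex.DeMoivre cis_mult by (simp add: algebra_simps)
      then show "?b c * cis (\<tau> * (real c - m) * g) =
          of_nat (n choose c) * (of_real p * cis (\<phi> + \<tau> * g)) ^ c * of_real (1 - p) ^ (n - c) *
          cis (- (\<tau> * g * m + \<phi> * d))"
        by (simp add: power_mult_distrib mult_ac)
    qed
  qed simp
  finally show ?thesis .
qed

text \<open>The range exceeds a half period because a Gaussian shift may enlarge the argument by one
  half; it still stays away from \<open>2 * pi\<close>, where the left side would fail. The constant
  36 suits the part where the cosine is nonpositive, as \<open>3 * pi / 2\<close> is below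
  6.\<close>

lemma one_minus_cos_ge:
  assumes "\<bar>x\<bar> \<le> 3 * pi / 2"
  shows "x\<^sup>2 / 36 \<le> 1 - cos x"
proof -
  have *: "y\<^sup>2 / 36 \<le> 1 - cos y" if y: "0 \<le> y" "y \<le> 3 * pi / 2" for y :: real
  proof (cases "y \<le> pi / 2")
    case True
    have "cmod (iexp y - (\<Sum>k\<le>2. (\<i> * y) ^ k / fact k)) \<le> \<bar>y\<bar> ^ Suc 2 / fact (Suc 2)"
      by (rule iexp_approx1)
    moreover have "Re (iexp y - (\<Sum>k\<le>2. (\<i> * y) ^ k / fact k)) = cos y - (1 - y\<^sup>2 / 2)"
      by (simp add: numeral_2_eq_2 cis_conv_exp[symmetric] power2_eq_square)
    ultimately have "cos y - (1 - y\<^sup>2 / 2) \<le> y ^ 3 / 6"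
      using abs_Re_le_cmod[of "iexp y - (\<Sum>k\<le>2. (\<i> * y) ^ k / fact k)"] y
      by (simp add: fact_numeral numeral_3_eq_3)
    moreover have "y ^ 3 \<le> 2 * y\<^sup>2"
      using mult_right_mono[of y 2 "y\<^sup>2"] True pi_less_4 by (simp add: power3_eq_cube power2_eq_square)
    ultimately show ?thesis using cos_le_one[of y] by linarith
  next
    case False
    then have "cos y \<le> 0" using y sin_ge_zero[of "y - pi / 2"] by (simp add: sin_diff)
    moreover have "y\<^sup>2 \<le> 6\<^sup>2" using y pi_less_4 by (intro power_mono) auto
    ultimately show ?thesis by simp
  qed
  show ?thesis using *[of "\<bar>x\<bar>"] assms by simp
qed

text \<open>The squared modulus equals \<open>1 - 2 * (p * (1 - p)) * (1 - cos x)\<close>. The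
  second bound then follows from \<open>one_minus_cos_ge\<close> and
  \<open>1 + z \<le> exp z\<close>.\<close>

lemma norm_bernoulli_char_le:
  assumes "0 \<le> p" "p \<le> 1"
  shows "norm (of_real (1 - p) + of_real p * cis x) \<le> 1"
    and "\<bar>x\<bar> \<le> 3 * pi / 2 \<Longrightarrow> norm (of_real (1 - p) + of_real p * cis x) \<le> exp (- (p * (1 - p) * x\<^sup>2 / 36))"
proof -
  let ?w = "of_real (1 - p) + of_real p * cis x"
  have quad: "(1 - p + p * a)\<^sup>2 + (p * b)\<^sup>2 = (1 - p)\<^sup>2 + 2 * (1 - p) * p * a + p\<^sup>2 * (a\<^sup>2 + b\<^sup>2)" for a b :: real
    by (simp add: power2_eq_square algebra_simps)
  have "(norm ?w)\<^sup>2 = (1 - p + p * cos x)\<^sup>2 + (p * sin x)\<^sup>2"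
    by (simp add: cmod_power2)
  also have "\<dots> = (1 - p)\<^sup>2 + 2 * (1 - p) * p * cos x + p\<^sup>2 * ((cos x)\<^sup>2 + (sin x)\<^sup>2)"
    using quad by blast
  also have "\<dots> = 1 - 2 * (p * (1 - p)) * (1 - cos x)"
    unfolding sin_cos_squared_add2 by (simp add: power2_eq_square algebra_simps)
  finally have eq: "(norm ?w)\<^sup>2 = 1 - 2 * (p * (1 - p)) * (1 - cos x)" .
  have pq: "0 \<le> p * (1 - p)" using assms by simp
  then have "(norm ?w)\<^sup>2 \<le> 1\<^sup>2" using eq by simp
  then show "norm ?w \<le> 1" by (rule power2_le_imp_le) simp
  assume x: "\<bar>x\<bar> \<le> 3 * pi / 2"
  have "(norm ?w)\<^sup>2 \<le> 1 + (- (2 * (p * (1 - p)) * (x\<^sup>2 / 36)))"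
    using mult_left_mono[OF one_minus_cos_ge[OF x], of "2 * (p * (1 - p))"] pq eq by simp
  also have "\<dots> \<le> exp (- (2 * (p * (1 - p)) * (x\<^sup>2 / 36)))"
    by (rule exp_ge_add_one_self)
  also have "\<dots> = (exp (- (p * (1 - p) * x\<^sup>2 / 36)))\<^sup>2"
    by (simp add: exp_double[symmetric])
  finally show "norm ?w \<le> exp (- (p * (1 - p) * x\<^sup>2 / 36))" by (rule power2_le_imp_le) simp
qed

lemma norm_smoothed_char_le_1:
  assumes "0 \<le> p" "p \<le> 1"
  shows "norm (smoothed_char n p \<tau> m d \<phi>) \<le> 1"
proof -
  have "norm (smoothed_char n p \<tau> m d \<phi>) \<le> (\<integral>g. norm ((of_real (1 - p) + of_real p * cis (\<phi> + \<tau> * g)) ^ n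
      * cis (- (\<tau> * g * m + \<phi> * d))) \<partial>std_normal_distribution)"
    unfolding smoothed_char_mixture by (rule integral_norm_bound)
  also have "\<dots> \<le> (\<integral>g. 1 \<partial>std_normal_distribution)"
  proof (rule integral_mono)
    have le: "norm ((of_real (1 - p) + of_real p * cis (\<phi> + \<tau> * g)) ^ n * cis (- (\<tau> * g * m + \<phi> * d))) \<le> 1" for g
      using norm_bernoulli_char_le(1)[OF assms] by (simp add: norm_mult norm_power power_le_one)
    then show "integrable std_normal_distribution (\<lambda>g. norm ((of_real (1 - p) + of_real p * cis (\<phi> + \<tau> * g)) ^ n
        * cis (- (\<tau> * g * m + \<phi> * d))))"
      by (intro std_normal.integrable_const_bound[where B = 1]) auto
  qed (use norm_bernoulli_char_le(1)[OF assms] in \<open>auto simp: norm_mult norm_power power_le_one\<close>)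
  finally show ?thesis using std_normal.prob_space by simp
qed

text \<open>The tail of the Gaussian mixing variable is only estimated by its second moment; this already
  yields an integrable majorant.\<close>

lemma norm_smoothed_char_le:
  assumes p: "0 \<le> p" "p \<le> 1" and "0 < R" "0 < \<delta>"
    and var: "\<delta> * R\<^sup>2 \<le> real n * (p * (1 - p))" and u: "\<bar>u\<bar> \<le> pi * R"
  shows "norm (smoothed_char n p (\<mu> / R) m d (u / R)) \<le> (2 + 144 / \<delta> + 4 * \<mu>\<^sup>2) / (1 + u\<^sup>2)"
proof -
  let ?w = "\<lambda>g. of_real (1 - p) + of_real p * cis (u / R + \<mu> / R * g)"
  let ?K = "2 + 144 / \<delta>"
  \<comment> \<open>If \<open>\<mu> * g\<close> is at most half of \<open>u\<close>, the shifted
    argument stays within \<open>3 * pi / 2\<close> and has at least half its original size, so the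
    Bernoulli bound gives Gaussian decay in \<open>u\<close>. Otherwise \<open>u\<^sup>2\<close> is
    below \<open>4 * \<mu>\<^sup>2 * g\<^sup>2\<close> and the trivial bound 1 suffices.\<close>
  have bound: "norm (?w g) ^ n \<le> (?K + 4 * \<mu>\<^sup>2 * g\<^sup>2) / (1 + u\<^sup>2)" for g
  proof (cases "\<bar>\<mu> * g\<bar> \<le> \<bar>u\<bar> / 2")
    case True
    define x where "x = (u + \<mu> * g) / R"
    have x: "u / R + \<mu> / R * g = x" by (simp add: x_def add_divide_distrib)
    have "\<bar>u + \<mu> * g\<bar> \<le> 3 * pi / 2 * R" using True u by linarith
    then have "\<bar>x\<bar> \<le> 3 * pi / 2" using assms(3) by (simp add: x_def divide_le_eq)
    then have "norm (?w g) \<le> exp (- (p * (1 - p) * x\<^sup>2 / 36))"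
      unfolding x using norm_bernoulli_char_le(2)[OF p] by blast
    then have "norm (?w g) ^ n \<le> exp (- (p * (1 - p) * x\<^sup>2 / 36)) ^ n"
      by (intro power_mono) auto
    also have "\<dots> = exp (- (real n * (p * (1 - p)) * x\<^sup>2 / 36))"
      by (simp add: exp_of_nat_mult[symmetric])
    also have "\<dots> \<le> exp (- (\<delta> * u\<^sup>2 / 144))"
    proof -
      have "(\<bar>u\<bar> / 2)\<^sup>2 \<le> \<bar>u + \<mu> * g\<bar>\<^sup>2" using True by (intro power_mono) linarith+
      then have "u\<^sup>2 / 4 \<le> R\<^sup>2 * x\<^sup>2" using assms(3) by (simp add: x_def power_divide)
      then have "\<delta> * (u\<^sup>2 / 4) \<le> \<delta> * R\<^sup>2 * x\<^sup>2" using assms(4) by simp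
      also have "\<dots> \<le> real n * (p * (1 - p)) * x\<^sup>2" using var by (intro mult_right_mono) auto
      finally show ?thesis by simp
    qed
    also have "\<dots> \<le> 1 / (1 + \<delta> * u\<^sup>2 / 144)"
      using assms(4) exp_ge_add_one_self[of "\<delta> * u\<^sup>2 / 144"]
      by (simp add: exp_minus inverse_eq_divide frac_le add_pos_nonneg)
    also have "\<dots> \<le> (?K + 4 * \<mu>\<^sup>2 * g\<^sup>2) / (1 + u\<^sup>2)"
    proof -
      \<comment> \<open>In \<open>?K\<close> the summand \<open>144 / \<delta>\<close> produces
        \<open>u\<^sup>2\<close> exactly, and 2 leaves room for the constant 1.\<close>
      have "1 + u\<^sup>2 \<le> ?K * (1 + \<delta> * u\<^sup>2 / 144)"
        using assms(4) by (simp add: field_simps)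
      also have "\<dots> \<le> (?K + 4 * \<mu>\<^sup>2 * g\<^sup>2) * (1 + \<delta> * u\<^sup>2 / 144)"
        using assms(4) by (intro mult_right_mono) auto
      finally have le: "1 + u\<^sup>2 \<le> (?K + 4 * \<mu>\<^sup>2 * g\<^sup>2) * (1 + \<delta> * u\<^sup>2 / 144)" .
      have pos: "0 < 1 + \<delta> * u\<^sup>2 / 144" "0 < 1 + u\<^sup>2" using assms(4) by (auto intro: add_pos_nonneg)
      have "1 / A \<le> K / U" if "0 < A" "0 < U" "U \<le> K * A" for A U K :: real
        using that by (simp add: divide_simps mult.commute)
      then show ?thesis using pos le by blast
    qed
    finally show ?thesis .
  next
    case False
    have "norm (?w g) ^ n \<le> 1"
      using norm_bernoulli_char_le(1)[OF p] by (simp add: power_le_one)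
    also have "1 \<le> (?K + 4 * \<mu>\<^sup>2 * g\<^sup>2) / (1 + u\<^sup>2)"
    proof -
      have "\<bar>u\<bar>\<^sup>2 \<le> (2 * \<bar>\<mu> * g\<bar>)\<^sup>2" using False by (intro power_mono) auto
      then have "1 + u\<^sup>2 \<le> 1 + 4 * \<mu>\<^sup>2 * g\<^sup>2" by (simp add: power_mult_distrib)
      moreover have "0 < 1 + u\<^sup>2" "1 \<le> ?K" using assms(4) by (auto intro: add_pos_nonneg)
      ultimately show ?thesis by (simp add: divide_simps)
    qed
    finally show ?thesis .
  qed
  have int2: "integrable std_normal_distribution (\<lambda>g. g\<^sup>2)"
    by (rule integrable_std_normal_distribution_moment)
  have "norm (smoothed_char n p (\<mu> / R) m d (u / R)) \<le> (\<integral>g. norm (?w g ^ n * cis (- (\<mu> / R * g * m + u / R * d))) \<partial>std_normal_distribution)"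
    unfolding smoothed_char_mixture by (rule integral_norm_bound)
  also have "\<dots> \<le> (\<integral>g. (?K + 4 * \<mu>\<^sup>2 * g\<^sup>2) / (1 + u\<^sup>2) \<partial>std_normal_distribution)"
  proof (rule integral_mono)
    show "integrable std_normal_distribution (\<lambda>g. norm (?w g ^ n * cis (- (\<mu> / R * g * m + u / R * d))))"
      using norm_bernoulli_char_le(1)[OF p]
      by (intro std_normal.integrable_const_bound[where B = 1]) (auto simp: norm_mult norm_power power_le_one)
    show "integrable std_normal_distribution (\<lambda>g. (?K + 4 * \<mu>\<^sup>2 * g\<^sup>2) / (1 + u\<^sup>2))"
      using int2 by (intro integrable_divide Bochner_Integration.integrable_add integrable_mult_right) auto
  qed (use bound in \<open>simp add: norm_mult norm_power\<close>)
  also have "\<dots> = (?K + 4 * \<mu>\<^sup>2) / (1 + u\<^sup>2)"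
    using int2 std_normal_distribution_even_moments[of 1] std_normal.prob_space by (simp add: fact_numeral)
  finally show ?thesis .
qed

text \<open>After centring, the factor is the \<open>p\<close>-mixture of
  \<open>cis ((1 - p) * x)\<close> and \<open>cis (- p * x)\<close>. The linear Taylor terms cancel
  and the quadratic ones add up to the variance \<open>p * (1 - p)\<close>. The cubic term of the
  bound is the Taylor remainder; the quartic one pays for replacing \<open>1 - z\<close> by
  \<open>exp (- z)\<close>.\<close>

lemma bernoulli_char_approx:
  assumes p: "0 \<le> p" "p \<le> 1"
  shows "norm ((of_real (1 - p) + of_real p * cis x) * cis (- (p * x)) - of_real (exp (- (p * (1 - p) * x\<^sup>2 / 2))))
    \<le> \<bar>x\<bar> ^ 3 / 6 + x ^ 4"
proof -
  have i_sq: "\<i> * complex_of_real y * (\<i> * complex_of_real y) = - (complex_of_real y * complex_of_real y)" for y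
    by (simp add: complex_eq_iff)
  have approx: "cmod (cis y - (1 + \<i> * y - y\<^sup>2 / 2)) \<le> \<bar>y\<bar> ^ 3 / 6" for y :: real
    using iexp_approx1[of y 2] i_sq[of y]
    by (simp add: numeral_2_eq_2 numeral_3_eq_3 cis_conv_exp power2_eq_square fact_numeral)
  define a b where "a = cis ((1 - p) * x) - (1 + \<i> * ((1 - p) * x) - ((1 - p) * x)\<^sup>2 / 2)"
    and "b = cis (- p * x) - (1 + \<i> * (- p * x) - (- p * x)\<^sup>2 / 2)"
  have na: "cmod a \<le> \<bar>x\<bar> ^ 3 / 6"
  proof -
    have "cmod a \<le> \<bar>(1 - p) * x\<bar> ^ 3 / 6" using approx[of "(1 - p) * x"] by (simp add: a_def)
    also have "\<dots> \<le> \<bar>x\<bar> ^ 3 / 6"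
      using p by (intro divide_right_mono power_mono) (auto simp: abs_mult mult_left_le_one_le)
    finally show ?thesis .
  qed
  have nb: "cmod b \<le> \<bar>x\<bar> ^ 3 / 6"
  proof -
    have "cmod b \<le> \<bar>- p * x\<bar> ^ 3 / 6" using approx[of "- p * x"] by (simp add: b_def)
    also have "\<dots> \<le> \<bar>x\<bar> ^ 3 / 6"
      using p by (intro divide_right_mono power_mono) (auto simp: abs_mult mult_left_le_one_le)
    finally show ?thesis .
  qed
  have "(of_real (1 - p) + of_real p * cis x) * cis (- (p * x)) = of_real p * cis ((1 - p) * x) + of_real (1 - p) * cis (- p * x)"
    by (simp add: ring_distribs mult.assoc cis_mult)
  also have "\<dots> = of_real p * a + of_real (1 - p) * b + of_real (1 - p * (1 - p) * x\<^sup>2 / 2)"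
    by (simp add: a_def b_def power2_eq_square field_simps)
  finally have eq: "(of_real (1 - p) + of_real p * cis x) * cis (- (p * x)) - of_real (exp (- (p * (1 - p) * x\<^sup>2 / 2)))
    = of_real p * a + of_real (1 - p) * b - of_real (exp (- (p * (1 - p) * x\<^sup>2 / 2)) - (1 - p * (1 - p) * x\<^sup>2 / 2))"
    by simp
  have "cmod (of_real p * a + of_real (1 - p) * b) \<le> p * (\<bar>x\<bar> ^ 3 / 6) + (1 - p) * (\<bar>x\<bar> ^ 3 / 6)"
    using mult_left_mono[OF na p(1)] mult_left_mono[OF nb, of "1 - p"] p
    by (intro norm_triangle_mono) (simp_all add: norm_mult del: of_real_diff)
  also have "p * (\<bar>x\<bar> ^ 3 / 6) + (1 - p) * (\<bar>x\<bar> ^ 3 / 6) = \<bar>x\<bar> ^ 3 / 6"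
    by (simp only: distrib_right[symmetric]) simp
  finally have 1: "cmod (of_real p * a + of_real (1 - p) * b) \<le> \<bar>x\<bar> ^ 3 / 6" .
  define z where "z = p * (1 - p) * x\<^sup>2 / 2"
  have z: "0 \<le> z" "z \<le> x\<^sup>2 / 2"
    using p mult_right_mono[OF mult_le_one[of p "1 - p"], of "x\<^sup>2"] by (auto simp: z_def)
  have "\<bar>exp (- z) - (1 - z)\<bar> \<le> x ^ 4"
  proof -
    have "1 - z \<le> exp (- z)" using exp_ge_add_one_self[of "- z"] by simp
    moreover have "exp (- z) \<le> 1 / (1 + z)"
      using z exp_ge_add_one_self[of z] by (simp add: exp_minus inverse_eq_divide frac_le)
    moreover have "1 / (1 + z) \<le> 1 - z + z\<^sup>2"
      using z by (simp add: divide_simps power2_eq_square algebra_simps)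
    moreover have "z\<^sup>2 \<le> (x\<^sup>2)\<^sup>2" using z by (intro power_mono) auto
    ultimately show ?thesis by (simp add: power_mult[symmetric])
  qed
  then have 2: "cmod (of_real (exp (- z) - (1 - z))) \<le> x ^ 4" by (simp only: norm_of_real)
  show ?thesis
    unfolding eq using order_trans[OF norm_triangle_ineq4 add_mono[OF 1 2]] by (simp only: z_def)
qed

text \<open>Completing the square in \<open>g\<close> turns the integrand into a constant times a
  normal density of variance \<open>1 / D\<close>, where
  \<open>D = 1 + k * \<mu>\<^sup>2\<close>.\<close>

lemma std_normal_gaussian_integral:
  assumes "0 \<le> k"
  shows "(\<integral>g. exp (- (k * (u + \<mu> * g)\<^sup>2 / 2)) \<partial>std_normal_distribution) =
    exp (- (k * u\<^sup>2 / (1 + k * \<mu>\<^sup>2) / 2)) / sqrt (1 + k * \<mu>\<^sup>2)"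
proof -
  define D where "D = 1 + k * \<mu>\<^sup>2"
  have D: "0 < D" using assms by (simp add: D_def add_pos_nonneg)
  have "std_normal_density g * exp (- (k * (u + \<mu> * g)\<^sup>2 / 2)) =
    exp (- (k * u\<^sup>2 / D / 2)) / sqrt D * normal_density (- (k * \<mu> * u / D)) (1 / sqrt D) g" for g
  proof -
    have sq: "- (g\<^sup>2) / 2 + - (k * (u + \<mu> * g)\<^sup>2 / 2) = - (k * u\<^sup>2 / D / 2) + - (D * (g + k * \<mu> * u / D)\<^sup>2 / 2)"
    proof -
      \<comment> \<open>Naming the quadratic terms makes the combination of the four expansions
        below purely linear.\<close>
      have lin: "- G / 2 + - (K / 2) = - (P / 2) + - (E / 2)"
        if "Q = P + W" "E = H + L + W" "H = G + M" "K = Q + L + M" for G K P E Q W H L M :: real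
        using that by (simp add: field_simps)
      have "k * u\<^sup>2 = k * u\<^sup>2 / D + (k * \<mu> * u)\<^sup>2 / D"
        using D by (simp add: field_simps) (simp add: D_def power2_eq_square algebra_simps)
      moreover have "D * (g + k * \<mu> * u / D)\<^sup>2 = D * g\<^sup>2 + 2 * k * \<mu> * u * g + (k * \<mu> * u)\<^sup>2 / D"
        using D by (simp add: field_simps power2_eq_square)
      moreover have "D * g\<^sup>2 = g\<^sup>2 + k * \<mu>\<^sup>2 * g\<^sup>2" by (simp add: D_def algebra_simps)
      moreover have "k * (u + \<mu> * g)\<^sup>2 = k * u\<^sup>2 + 2 * k * \<mu> * u * g + k * \<mu>\<^sup>2 * g\<^sup>2"
        by (simp add: power2_eq_square algebra_simps)
      ultimately show ?thesis by (rule lin)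
    qed
    have "std_normal_density g * exp (- (k * (u + \<mu> * g)\<^sup>2 / 2)) =
      1 / sqrt (2 * pi) * exp (- (g\<^sup>2) / 2 + - (k * (u + \<mu> * g)\<^sup>2 / 2))"
      by (simp only: std_normal_density_def exp_add mult.assoc)
    also have "\<dots> = 1 / sqrt (2 * pi) * (exp (- (k * u\<^sup>2 / D / 2)) * exp (- (D * (g + k * \<mu> * u / D)\<^sup>2 / 2)))"
      by (simp only: sq exp_add)
    also have "\<dots> = exp (- (k * u\<^sup>2 / D / 2)) / sqrt D * normal_density (- (k * \<mu> * u / D)) (1 / sqrt D) g"
      using D by (simp add: normal_density_def real_sqrt_divide power_divide mult.commute)
    finally show ?thesis .
  qed
  then show ?thesis
    using D by (subst integral_density) (simp_all add: D_def[symmetric])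
qed

lemma integral_gaussian:
  assumes "0 < c"
  shows "integrable lborel (\<lambda>u. exp (- (c * u\<^sup>2 / 2)))"
    and "(\<integral>u. exp (- (c * u\<^sup>2 / 2)) \<partial>lborel) = sqrt (2 * pi / c)"
proof -
  have eq: "exp (- (c * u\<^sup>2 / 2)) = sqrt (2 * pi / c) * normal_density 0 (1 / sqrt c) u" for u
    using assms by (simp add: normal_density_def real_sqrt_divide power_divide mult.commute)
  show "integrable lborel (\<lambda>u. exp (- (c * u\<^sup>2 / 2)))"
    "(\<integral>u. exp (- (c * u\<^sup>2 / 2)) \<partial>lborel) = sqrt (2 * pi / c)"
    unfolding eq using assms by simp_all
qed

text \<open>A central limit theorem for binomials with varying parameters. Powers of numbers in the
  unit disc differ by at most \<open>n\<close> times the difference of the bases, which is of order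
  \<open>R\<close> to the power -3, while \<open>n\<close> is of order
  \<open>R\<^sup>2\<close>.\<close>

lemma tendsto_bernoulli_char_power:
  fixes n :: "nat \<Rightarrow> nat" and p R :: "nat \<Rightarrow> real"
  assumes p: "\<And>i. 0 \<le> p i" "\<And>i. p i \<le> 1" and R: "\<And>i. 0 < R i" "filterlim R at_top sequentially"
    and n: "(\<lambda>i. real (n i) / (R i)\<^sup>2) \<longlonglongrightarrow> \<nu>" and p0: "p \<longlonglongrightarrow> p0"
  shows "(\<lambda>i. ((of_real (1 - p i) + of_real (p i) * cis (v / R i)) * cis (- (p i * (v / R i)))) ^ n i)
    \<longlonglongrightarrow> of_real (exp (- (\<nu> * (p0 * (1 - p0)) * v\<^sup>2 / 2)))"
proof -
  define z where "z i = (of_real (1 - p i) + of_real (p i) * cis (v / R i)) * cis (- (p i * (v / R i)))" for i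
  define y where "y i = complex_of_real (exp (- (p i * (1 - p i) * (v / R i)\<^sup>2 / 2)))" for i
  have inv: "(\<lambda>i. 1 / R i) \<longlonglongrightarrow> 0"
    using R(2) by (auto intro: tendsto_divide_0 filterlim_at_top_imp_at_infinity)
  have y_pow: "y i ^ n i = of_real (exp (- ((real (n i) / (R i)\<^sup>2) * (p i * (1 - p i)) * v\<^sup>2 / 2)))" for i
    using R(1)[of i] unfolding y_def of_real_power[symmetric] exp_of_nat_mult[symmetric]
    by (simp add: power_divide field_simps)
  have "(\<lambda>i. y i ^ n i) \<longlonglongrightarrow> of_real (exp (- (\<nu> * (p0 * (1 - p0)) * v\<^sup>2 / 2)))"
    unfolding y_pow by (intro tendsto_intros n p0) simp
  moreover have "(\<lambda>i. z i ^ n i - y i ^ n i) \<longlonglongrightarrow> 0"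
  proof (rule Lim_null_comparison)
    show "\<forall>\<^sub>F i in sequentially. norm (z i ^ n i - y i ^ n i) \<le>
      (real (n i) / (R i)\<^sup>2) * (\<bar>v\<bar> ^ 3 / 6 * (1 / R i) + v ^ 4 * (1 / R i)\<^sup>2)"
    proof (rule always_eventually, rule allI)
      fix i
      have "norm (z i) \<le> 1"
        using norm_bernoulli_char_le(1)[OF p] by (simp add: z_def norm_mult)
      moreover have "norm (y i) \<le> 1" using p[of i] by (simp add: y_def)
      ultimately have "norm (z i ^ n i - y i ^ n i) \<le> real (n i) * norm (z i - y i)"
        by (rule norm_power_diff)
      also have "\<dots> \<le> real (n i) * (\<bar>v / R i\<bar> ^ 3 / 6 + (v / R i) ^ 4)"
        unfolding z_def y_def by (intro mult_left_mono bernoulli_char_approx p) auto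
      also have "\<dots> = (real (n i) / (R i)\<^sup>2) * (\<bar>v\<bar> ^ 3 / 6 * (1 / R i) + v ^ 4 * (1 / R i)\<^sup>2)"
        using R(1)[of i] by (simp add: field_simps power2_eq_square power3_eq_cube power4_eq_xxxx)
      finally show "norm (z i ^ n i - y i ^ n i) \<le>
        (real (n i) / (R i)\<^sup>2) * (\<bar>v\<bar> ^ 3 / 6 * (1 / R i) + v ^ 4 * (1 / R i)\<^sup>2)" .
    qed
    have "(\<lambda>i. (real (n i) / (R i)\<^sup>2) * (\<bar>v\<bar> ^ 3 / 6 * (1 / R i) + v ^ 4 * (1 / R i)\<^sup>2))
      \<longlonglongrightarrow> \<nu> * (\<bar>v\<bar> ^ 3 / 6 * 0 + v ^ 4 * 0\<^sup>2)"
      by (intro tendsto_intros n inv)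
    then show "(\<lambda>i. (real (n i) / (R i)\<^sup>2) * (\<bar>v\<bar> ^ 3 / 6 * (1 / R i) + v ^ 4 * (1 / R i)\<^sup>2)) \<longlonglongrightarrow> 0"
      by simp
  qed
  ultimately show ?thesis
    unfolding z_def[symmetric] using tendsto_add[of "\<lambda>i. z i ^ n i - y i ^ n i" 0 sequentially "\<lambda>i. y i ^ n i"] by simp
qed

text \<open>For fixed \<open>g\<close> the mixture integrand is a centred binomial characteristic
  function at \<open>(u + \<mu> * g) / R\<close>, up to a vanishing phase. It is bounded by 1, so
  dominated convergence reduces the limit to \<open>std_normal_gaussian_integral\<close>.\<close>

lemma tendsto_smoothed_char:
  fixes n :: "nat \<Rightarrow> nat" and p R d :: "nat \<Rightarrow> real"
  assumes p: "\<And>i. 0 \<le> p i" "\<And>i. p i \<le> 1" and R: "\<And>i. 0 < R i" "filterlim R at_top sequentially"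
    and n: "(\<lambda>i. real (n i) / (R i)\<^sup>2) \<longlonglongrightarrow> \<nu>" and p0: "p \<longlonglongrightarrow> p0"
    and d: "\<And>i. \<bar>real (n i) * p i - d i\<bar> \<le> 1" and k: "k = \<nu> * (p0 * (1 - p0))" "0 \<le> k"
  shows "(\<lambda>i. smoothed_char (n i) (p i) (\<mu> / R i) (d i - e) (d i) (u / R i))
    \<longlonglongrightarrow> of_real (exp (- (k * u\<^sup>2 / (1 + k * \<mu>\<^sup>2) / 2)) / sqrt (1 + k * \<mu>\<^sup>2))"
proof -
  define f where "f i g = (of_real (1 - p i) + of_real (p i) * cis (u / R i + \<mu> / R i * g)) ^ n i *
    cis (- (\<mu> / R i * g * (d i - e) + u / R i * d i))" for i g
  have inv: "(\<lambda>i. 1 / R i) \<longlonglongrightarrow> 0"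
    using R(2) by (auto intro: tendsto_divide_0 filterlim_at_top_imp_at_infinity)
  have lim: "(\<lambda>i. f i g) \<longlonglongrightarrow> of_real (exp (- (k * (u + \<mu> * g)\<^sup>2 / 2)))" for g
  proof -
    define v where "v = u + \<mu> * g"
    have f: "f i g = ((of_real (1 - p i) + of_real (p i) * cis (v / R i)) * cis (- (p i * (v / R i)))) ^ n i *
      cis (v * (real (n i) * p i - d i) * (1 / R i) + \<mu> * g * e * (1 / R i))" for i
    proof -
      have x: "u / R i + \<mu> / R i * g = v / R i" by (simp add: v_def add_divide_distrib)
      \<comment> \<open>The phase is split into the exact centring at the mean \<open>n * p\<close>
        and a rest: \<open>d\<close> is within 1 of the mean and \<open>e\<close> is fixed, so the
        rest is of order \<open>1 / R\<close>.\<close>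
      have "- (\<mu> / R i * g * (d i - e) + u / R i * d i) = real (n i) * (- (p i * (v / R i))) +
        (v * (real (n i) * p i - d i) * (1 / R i) + \<mu> * g * e * (1 / R i))"
        using R(1)[of i] by (simp add: v_def field_simps)
      then have "cis (- (\<mu> / R i * g * (d i - e) + u / R i * d i)) = cis (- (p i * (v / R i))) ^ n i *
        cis (v * (real (n i) * p i - d i) * (1 / R i) + \<mu> * g * e * (1 / R i))"
        by (simp only: Complex.DeMoivre cis_mult)
      then show ?thesis unfolding f_def x by (simp only: power_mult_distrib mult.assoc)
    qed
    have "(\<lambda>i. v * (real (n i) * p i - d i) * (1 / R i)) \<longlonglongrightarrow> 0"
    proof (rule Lim_null_comparison)
      show "\<forall>\<^sub>F i in sequentially. norm (v * (real (n i) * p i - d i) * (1 / R i)) \<le> \<bar>v\<bar> * (1 / R i)"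
      proof (rule always_eventually, rule allI)
        fix i show "norm (v * (real (n i) * p i - d i) * (1 / R i)) \<le> \<bar>v\<bar> * (1 / R i)"
          using mult_right_mono[OF mult_left_mono[OF d[of i], of "\<bar>v\<bar>"], of "1 / R i"] R(1)[of i]
          by (simp add: abs_mult)
      qed
      show "(\<lambda>i. \<bar>v\<bar> * (1 / R i)) \<longlonglongrightarrow> 0" using tendsto_mult_left[OF inv, of "\<bar>v\<bar>"] by simp
    qed
    moreover have "(\<lambda>i. \<mu> * g * e * (1 / R i)) \<longlonglongrightarrow> 0" using tendsto_mult_left[OF inv, of "\<mu> * g * e"] by simp
    ultimately have "(\<lambda>i. cis (v * (real (n i) * p i - d i) * (1 / R i) + \<mu> * g * e * (1 / R i))) \<longlonglongrightarrow> cis (0 + 0)"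
      by (intro tendsto_cis tendsto_add)
    then show ?thesis
      unfolding f k(1) v_def[symmetric]
      using tendsto_mult[OF tendsto_bernoulli_char_power[OF p R n p0, of v]] by fastforce
  qed
  have "(\<lambda>i. CLINT g|std_normal_distribution. f i g) \<longlonglongrightarrow>
    (CLINT g|std_normal_distribution. of_real (exp (- (k * (u + \<mu> * g)\<^sup>2 / 2))))"
  proof (rule integral_dominated_convergence[where w = "\<lambda>_. 1"])
    show "AE g in std_normal_distribution. norm (f i g) \<le> 1" for i
      using norm_bernoulli_char_le(1)[OF p] by (auto simp: f_def norm_mult norm_power power_le_one)
    show "AE g in std_normal_distribution. (\<lambda>i. f i g) \<longlonglongrightarrow> of_real (exp (- (k * (u + \<mu> * g)\<^sup>2 / 2)))"
      using lim by simp
  qed (simp_all add: f_def)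
  then show ?thesis
    unfolding smoothed_char_mixture f_def[symmetric] integral_complex_of_real
      std_normal_gaussian_integral[OF k(2)] .
qed

section \<open>Fourier inversion over the residue classes\<close>

lemma sum_Pow_card:
  fixes h :: "nat \<Rightarrow> 'c::comm_semiring_1"
  assumes "finite A"
  shows "(\<Sum>X\<in>Pow A. h (card X)) = (\<Sum>c\<le>card A. of_nat (card A choose c) * h c)"
proof -
  have "(\<Sum>X\<in>Pow A. h (card X)) = (\<Sum>c\<le>card A. \<Sum>X\<in>{X \<in> Pow A. card X = c}. h (card X))"
    using assms by (intro sum.group[symmetric]) (auto intro: card_mono)
  also have "\<dots> = (\<Sum>c\<le>card A. of_nat (card A choose c) * h c)"
    using n_subsets[OF assms] by (intro sum.cong) simp_all
  finally show ?thesis .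
qed

text \<open>A subset is an independent choice of a subset in each residue class. The factorisation
  is over all subsets; the cardinality constraint is imposed later by Fourier inversion.\<close>

lemma sum_Pow_residue_count:
  fixes h :: "nat \<Rightarrow> nat \<Rightarrow> 'c::comm_semiring_1"
  assumes "0 < t"
  shows "(\<Sum>B\<in>Pow {..<N}. \<Prod>a<t. h a (residue_count t B a)) =
    (\<Prod>a<t. \<Sum>c\<le>residue_count t {..<N} a. of_nat (residue_count t {..<N} a choose c) * h a c)"
proof -
  define A where "A a = {b \<in> {..<N}. b mod t = a}" for a
  have "(\<Sum>B\<in>Pow {..<N}. \<Prod>a<t. h a (residue_count t B a)) =
    (\<Sum>g\<in>PiE {..<t} (\<lambda>a. Pow (A a)). \<Prod>a<t. h a (card (g a)))"
  proof (rule sum.reindex_bij_witness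
      [where j = "\<lambda>B. \<lambda>a\<in>{..<t}. {b \<in> B. b mod t = a}" and i = "\<lambda>g. \<Union>a<t. g a"])
    fix B assume "B \<in> Pow {..<N}"
    then show "(\<Union>a<t. (\<lambda>a\<in>{..<t}. {b \<in> B. b mod t = a}) a) = B"
      "(\<lambda>a\<in>{..<t}. {b \<in> B. b mod t = a}) \<in> PiE {..<t} (\<lambda>a. Pow (A a))"
      using assms by (auto simp: A_def)
    show "(\<Prod>a<t. h a (card ((\<lambda>a\<in>{..<t}. {b \<in> B. b mod t = a}) a))) = (\<Prod>a<t. h a (residue_count t B a))"
      by (intro prod.cong) (simp_all add: residue_count_def)
  next
    fix g assume g: "g \<in> PiE {..<t} (\<lambda>a. Pow (A a))"
    then have sub: "g a \<subseteq> A a" if "a < t" for a using that by auto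
    then show "(\<Union>a<t. g a) \<in> Pow {..<N}" by (fastforce simp: A_def)
    have eq: "{b \<in> \<Union>a<t. g a. b mod t = a} = g a" if "a < t" for a
      using sub that by (fastforce simp: A_def)
    show "(\<lambda>a\<in>{..<t}. {b \<in> \<Union>a<t. g a. b mod t = a}) = g"
    proof
      fix a
      show "(\<lambda>a\<in>{..<t}. {b \<in> \<Union>a<t. g a. b mod t = a}) a = g a"
        using eq[of a] PiE_arb[OF g, of a] by (cases "a < t") (simp_all only: restrict_apply lessThan_iff if_True if_False simp_thms)
    qed
  qed
  also have "\<dots> = (\<Prod>a<t. \<Sum>X\<in>Pow (A a). h a (card X))"
    by (rule prod_sum_PiE[symmetric]) (simp_all add: A_def)
  also have "\<dots> = (\<Prod>a<t. \<Sum>c\<le>residue_count t {..<N} a. of_nat (residue_count t {..<N} a choose c) * h a c)"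
    unfolding residue_count_def A_def by (intro prod.cong sum_Pow_card) simp_all
  finally show ?thesis .
qed

lemma residue_count_lessThan_bounds:
  assumes "a < t"
  shows "\<bar>real (residue_count t {..<N} a) - real N / real t\<bar> \<le> 1"
proof -
  define q where "q = N div t"
  have t: "0 < t" using assms by simp
  have inj: "inj (\<lambda>k. a + t * k)" using t by (auto simp: inj_on_def)
  have "(\<lambda>k. a + t * k) ` {..<q} \<subseteq> {b \<in> {..<N}. b mod t = a}"
  proof
    fix b assume "b \<in> (\<lambda>k. a + t * k) ` {..<q}"
    then obtain k where k: "k < q" "b = a + t * k" by auto
    have "b < t * Suc k" using k assms by simp
    also have "\<dots> \<le> t * q" using k by (intro mult_le_mono) auto
    also have "\<dots> \<le> N" by (simp add: q_def)
    finally show "b \<in> {b \<in> {..<N}. b mod t = a}" using k assms by simp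
  qed
  from card_mono[OF _ this] have "q \<le> residue_count t {..<N} a"
    using inj by (simp add: residue_count_def card_image inj_on_subset)
  moreover
  have "{b \<in> {..<N}. b mod t = a} \<subseteq> (\<lambda>k. a + t * k) ` {..<Suc q}"
  proof
    fix b assume b: "b \<in> {b \<in> {..<N}. b mod t = a}"
    then have "b = a + t * (b div t)" using mod_mult_div_eq[of b t] by simp
    moreover have "b div t \<le> q" using b by (simp add: q_def div_le_mono)
    ultimately show "b \<in> (\<lambda>k. a + t * k) ` {..<Suc q}" by (metis image_eqI lessThan_iff le_imp_less_Suc)
  qed
  from card_mono[OF _ this] have "residue_count t {..<N} a \<le> Suc q"
    using inj by (simp add: residue_count_def card_image inj_on_subset)
  moreover have "real q \<le> real N / real t" "real N / real t \<le> real q + 1"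
  proof -
    have "N = t * q + N mod t" "N mod t < t" using t by (simp_all add: q_def)
    then have "real N = real t * real q + real (N mod t)" "real (N mod t) < real t"
      by (metis of_nat_add of_nat_mult, simp)
    then show "real q \<le> real N / real t" "real N / real t \<le> real q + 1"
      using t by (simp_all add: field_simps)
  qed
  ultimately show ?thesis by linarith
qed

text \<open>Orthogonality of characters, over a period stretched by \<open>R\<close> so that
  integrands can converge at fixed \<open>u\<close>.\<close>

lemma integral_cis_period:
  fixes k :: int
  assumes "0 < R"
  shows "has_bochner_integral lborel (\<lambda>u. indicator {- pi * R..pi * R} u *\<^sub>R cis (u / R * of_int k))
    (of_real (if k = 0 then 2 * pi * R else 0))"
proof (cases "k = 0")
  case True
  have der: "(complex_of_real has_vector_derivative 1) (at u within S)" for u S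
    using has_vector_derivative_real_field[of "\<lambda>w. w" 1 u S] by simp
  have "has_bochner_integral lborel (\<lambda>u. indicator {- pi * R..pi * R} u *\<^sub>R (1 :: complex))
    (of_real (pi * R) - of_real (- pi * R))"
    by (rule has_bochner_integral_FTC_Icc[OF _ der]) (use assms in auto)
  then show ?thesis using True by (simp add: mult_ac)
next
  case False
  define F where "F w = of_real (R / of_int k) * - \<i> * exp (\<i> * (w / of_real R * of_int k))" for w :: complex
  have der: "((\<lambda>u. F (of_real u)) has_vector_derivative cis (u / R * of_int k)) (at u within S)" for u S
  proof (rule has_vector_derivative_real_field)
    have "(F has_field_derivative of_real (R / of_int k) * - \<i> * (exp (\<i> * (of_real u / of_real R * of_int k)) *
        (\<i> * (1 / of_real R * of_int k)))) (at (of_real u))"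
      unfolding F_def using assms by (intro derivative_intros DERIV_cmult) (auto intro!: derivative_eq_intros)
    moreover have "of_real (R / of_int k) * - \<i> * (exp (\<i> * (of_real u / of_real R * of_int k)) *
        (\<i> * (1 / of_real R * of_int k))) = cis (u / R * of_int k)"
      using assms False by (simp add: cis_conv_exp field_simps)
    ultimately show "(F has_field_derivative cis (u / R * of_int k)) (at (of_real u))" by simp
  qed
  have "has_bochner_integral lborel (\<lambda>u. indicator {- pi * R..pi * R} u *\<^sub>R cis (u / R * of_int k))
    (F (of_real (pi * R)) - F (of_real (- pi * R)))"
    by (rule has_bochner_integral_FTC_Icc[OF _ der]) (use assms in \<open>auto intro!: continuous_intros\<close>)
  moreover have "F (of_real (pi * R)) = F (of_real (- pi * R))"
  proof -
    have F: "F (of_real v) = of_real (R / of_int k) * - \<i> * cis (v / R * of_int k)" for v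
      by (simp add: F_def cis_conv_exp)
    have "cis (pi * of_int k) = cis (- (pi * of_int k))"
      by (simp add: complex_eq_iff mult.commute[of pi] sin_times_pi_eq_0)
    then show ?thesis unfolding F using assms by simp
  qed
  ultimately show ?thesis using False by simp
qed

text \<open>Expanding the product over classes gives a sum over all subsets \<open>B\<close>. The
  phase centres \<open>r / t\<close> add up to \<open>r\<close>, so the total phase is that of
  \<open>card B - r\<close> and integration selects \<open>card B = r\<close>. On these subsets the
  binomial weight is constant, so \<open>p\<close> acts as a free tilting parameter.\<close>

lemma fourier_residue_counts:
  fixes m :: "nat \<Rightarrow> real"
  assumes t: "0 < t" and R: "0 < R" and "r \<le> N"
  shows "of_real (2 * pi * R * (p ^ r * (1 - p) ^ (N - r)) *
      (\<Sum>B\<in>{B. B \<subseteq> {..<N} \<and> card B = r}. exp (- (\<Sum>a<t. (\<tau> * (real (residue_count t B a) - m a))\<^sup>2) / 2))) =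
    (\<integral>u. indicator {- pi * R..pi * R} u *\<^sub>R
      (\<Prod>a<t. smoothed_char (residue_count t {..<N} a) p \<tau> (m a) (real r / real t) (u / R)) \<partial>lborel)"
proof -
  define K where "K B = p ^ card B * (1 - p) ^ (N - card B) *
    exp (- (\<Sum>a<t. (\<tau> * (real (residue_count t B a) - m a))\<^sup>2) / 2)" for B
  let ?n = "residue_count t {..<N}"
  have prod: "(\<Prod>a<t. smoothed_char (?n a) p \<tau> (m a) (real r / real t) \<phi>) =
    (\<Sum>B\<in>Pow {..<N}. of_real (K B) * cis (\<phi> * of_int (int (card B) - int r)))" for \<phi>
  proof -
    define h where "h a c = of_real (p ^ c * (1 - p) ^ (?n a - c) * exp (- (\<tau> * (real c - m a))\<^sup>2 / 2))
      * cis (\<phi> * (real c - real r / real t))" for a c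
    have "(\<Prod>a<t. smoothed_char (?n a) p \<tau> (m a) (real r / real t) \<phi>) =
      (\<Prod>a<t. \<Sum>c\<le>?n a. of_nat (?n a choose c) * h a c)"
      unfolding smoothed_char_def h_def by (intro prod.cong sum.cong) (simp_all add: mult.assoc)
    also have "\<dots> = (\<Sum>B\<in>Pow {..<N}. \<Prod>a<t. h a (residue_count t B a))"
      by (rule sum_Pow_residue_count[OF t, symmetric])
    also have "\<dots> = (\<Sum>B\<in>Pow {..<N}. of_real (K B) * cis (\<phi> * of_int (int (card B) - int r)))"
    proof (rule sum.cong[OF refl])
      fix B assume "B \<in> Pow {..<N}"
      then have B: "B \<subseteq> {..<N}" "finite B" using finite_subset by auto
      have le: "residue_count t B a \<le> ?n a" for a
        unfolding residue_count_def using B by (intro card_mono) auto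
      have tot: "(\<Sum>a<t. residue_count t B a) = card B" "(\<Sum>a<t. ?n a) = N"
        using sum_residue_count[OF B(2) t] sum_residue_count[of "{..<N}" t] t by simp_all
      have "(\<Sum>a<t. ?n a - residue_count t B a) = N - card B"
        using sum_subtractf_nat[of "{..<t}" "residue_count t B" ?n] le tot by simp
      moreover have cs: "(\<Prod>a<t. cis (f a)) = cis (\<Sum>a<t. f a)" for f
        by (induction t) (simp_all add: cis_mult)
      moreover have "(\<Sum>a<t. \<phi> * (real (residue_count t B a) - real r / real t)) = \<phi> * of_int (int (card B) - int r)"
        using t tot(1) by (simp add: sum_distrib_left[symmetric] sum_subtractf of_nat_sum[symmetric] del: of_nat_sum)
      moreover have "(\<Prod>a<t. exp (- (f a) / 2)) = exp (- (\<Sum>a<t. f a) / 2)" for f :: "nat \<Rightarrow> real"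
        by (simp add: exp_sum[symmetric] sum_negf sum_divide_distrib)
      ultimately show "(\<Prod>a<t. h a (residue_count t B a)) = of_real (K B) * cis (\<phi> * of_int (int (card B) - int r))"
        unfolding h_def K_def prod.distrib of_real_prod[symmetric]
        by (simp only: power_sum[symmetric] tot)
    qed
    finally show ?thesis .
  qed
  have "has_bochner_integral lborel (\<lambda>u. \<Sum>B\<in>Pow {..<N}. of_real (K B) *
      (indicator {- pi * R..pi * R} u *\<^sub>R cis (u / R * of_int (int (card B) - int r))))
    (\<Sum>B\<in>Pow {..<N}. of_real (K B) * of_real (if int (card B) - int r = 0 then 2 * pi * R else 0))"
    by (intro has_bochner_integral_sum has_bochner_integral_mult_right integral_cis_period R)
  then have "(\<integral>u. indicator {- pi * R..pi * R} u *\<^sub>R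
      (\<Prod>a<t. smoothed_char (?n a) p \<tau> (m a) (real r / real t) (u / R)) \<partial>lborel) =
    (\<Sum>B\<in>Pow {..<N}. of_real (K B) * of_real (if int (card B) - int r = 0 then 2 * pi * R else 0))"
    unfolding prod scaleR_sum_right by (simp add: has_bochner_integral_integral_eq mult.left_commute scaleR_conv_of_real)
  also have "\<dots> = of_real (\<Sum>B\<in>Pow {..<N}. if card B = r then K B * (2 * pi * R) else 0)"
    unfolding of_real_sum by (intro sum.cong) auto
  also have "(\<Sum>B\<in>Pow {..<N}. if card B = r then K B * (2 * pi * R) else 0) =
    (\<Sum>B\<in>{B. B \<subseteq> {..<N} \<and> card B = r}. K B * (2 * pi * R))"
    by (subst sum.inter_filter[symmetric]) (auto intro: sum.cong)
  also have "\<dots> = 2 * pi * R * (p ^ r * (1 - p) ^ (N - r)) *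
      (\<Sum>B\<in>{B. B \<subseteq> {..<N} \<and> card B = r}. exp (- (\<Sum>a<t. (\<tau> * (real (residue_count t B a) - m a))\<^sup>2) / 2))"
    unfolding sum_distrib_left by (intro sum.cong) (auto simp: K_def)
  finally show ?thesis ..
qed

section \<open>Limit of the Fourier integrals and the Laplace transform of the scaled core\<close>

lemma integrable_inverse_1_plus_square_lborel: "integrable lborel (\<lambda>u::real. 1 / (1 + u\<^sup>2))"
  using integrable_inverse_1_plus_square by (simp add: set_integrable_def inverse_eq_divide)

text \<open>Tilting by \<open>p = r / (r + s)\<close> gives every class a mean within 1 of
  \<open>r / t\<close>, and \<open>k\<close> is the limit of the variance of a class count divided
  by \<open>r\<close>. The factors converge to Gaussians in \<open>u\<close>, and dominated
  convergence passes the limit through the integral.\<close>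

lemma tendsto_fourier_integral:
  fixes r s :: "nat \<Rightarrow> nat" and \<kappa> \<mu> :: real
  assumes t: "0 < t" and \<kappa>: "0 < \<kappa>" and rpos: "\<And>n. 0 < r n"
    and r: "filterlim r at_top sequentially"
    and lim: "(\<lambda>n. real (s n) / real (r n)) \<longlonglongrightarrow> \<kappa>"
  defines "p \<equiv> \<lambda>n. real (r n) / real (r n + s n)" and "R \<equiv> \<lambda>n. sqrt (real (r n))"
    and "k \<equiv> \<kappa> / (real t * (1 + \<kappa>))"
  shows "(\<lambda>n. \<integral>u. indicator {- pi * R n..pi * R n} u *\<^sub>R
      (\<Prod>a<t. smoothed_char (residue_count t {..<r n + s n} a) (p n) (\<mu> / R n)
        ((real (r n) - real a) / real t) (real (r n) / real t) (u / R n)) \<partial>lborel)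
    \<longlonglongrightarrow> of_real (sqrt (2 * pi / (real t * k)) * (sqrt (1 + k * \<mu>\<^sup>2) / sqrt (1 + k * \<mu>\<^sup>2) ^ t))"
proof -
  define D where "D = 1 + k * \<mu>\<^sup>2"
  define c where "c n a = residue_count t {..<r n + s n} a" for n a
  define d where "d n = real (r n) / real t" for n
  define F where "F n a u = smoothed_char (c n a) (p n) (\<mu> / R n) (d n - real a / real t) (d n) (u / R n)" for n a u
  have k: "0 < k" using t \<kappa> by (simp add: k_def)
  have D: "0 < D" using k by (simp add: D_def add_pos_nonneg)
  have p01: "0 \<le> p n" "p n \<le> 1" for n by (simp_all add: p_def divide_le_eq)
  have R: "0 < R n" "(R n)\<^sup>2 = real (r n)" for n using rpos by (simp_all add: R_def)
  have Rlim: "filterlim R at_top sequentially"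
    unfolding R_def by (intro filterlim_compose[OF sqrt_at_top] filterlim_compose[OF filterlim_real_sequentially] r)
  have inv: "(\<lambda>n. 1 / real (r n)) \<longlonglongrightarrow> 0"
    using filterlim_compose[OF filterlim_real_sequentially r]
    by (auto intro: tendsto_divide_0 filterlim_at_top_imp_at_infinity)
  have ratio: "(\<lambda>n. 1 + real (s n) / real (r n)) \<longlonglongrightarrow> 1 + \<kappa>"
    by (intro tendsto_intros lim)
  have plim: "p \<longlonglongrightarrow> 1 / (1 + \<kappa>)"
  proof -
    have "p n = 1 / (1 + real (s n) / real (r n))" for n
      using rpos[of n] by (simp add: p_def field_simps)
    then have "p = (\<lambda>n. 1 / (1 + real (s n) / real (r n)))" by (rule ext)
    then show ?thesis using \<kappa> tendsto_divide[OF tendsto_const ratio, of 1] by simp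
  qed
  have clim: "(\<lambda>n. real (c n a) / (R n)\<^sup>2) \<longlonglongrightarrow> (1 + \<kappa>) / real t" if "a < t" for a
  proof -
    have "(\<lambda>n. (real (c n a) - real (r n + s n) / real t) * (1 / real (r n))) \<longlonglongrightarrow> 0"
    proof (rule Lim_null_comparison[OF _ inv], rule always_eventually, rule allI)
      fix n
      show "norm ((real (c n a) - real (r n + s n) / real t) * (1 / real (r n))) \<le> 1 / real (r n)"
        using residue_count_lessThan_bounds[OF that, of "r n + s n"] rpos[of n]
        by (simp add: c_def abs_mult divide_le_cancel)
    qed
    moreover have "(\<lambda>n. (1 + real (s n) / real (r n)) / real t) \<longlonglongrightarrow> (1 + \<kappa>) / real t"
      using t by (intro tendsto_divide[OF ratio tendsto_const]) simp
    ultimately have "(\<lambda>n. (real (c n a) - real (r n + s n) / real t) * (1 / real (r n)) +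
        (1 + real (s n) / real (r n)) / real t) \<longlonglongrightarrow> 0 + (1 + \<kappa>) / real t"
      by (rule tendsto_add)
    moreover have "real (c n a) / (R n)\<^sup>2 = (real (c n a) - real (r n + s n) / real t) * (1 / real (r n)) +
        (1 + real (s n) / real (r n)) / real t" for n
      using rpos[of n] t by (simp add: R(2) field_simps)
    ultimately show ?thesis by simp
  qed
  have centre: "\<bar>real (c n a) * p n - d n\<bar> \<le> 1" if "a < t" for n a
  proof -
    have "real (c n a) * p n - d n = (real (c n a) - real (r n + s n) / real t) * p n"
      using rpos[of n] t by (simp add: d_def p_def field_simps)
    also have "\<bar>\<dots>\<bar> \<le> 1 * 1"
      unfolding abs_mult c_def
      by (intro mult_mono residue_count_lessThan_bounds that) (use p01 in auto)
    finally show ?thesis by simp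
  qed
  have keq: "k = (1 + \<kappa>) / real t * (1 / (1 + \<kappa>) * (1 - 1 / (1 + \<kappa>)))"
  proof -
    have "\<kappa> / (real t * y) = y / real t * (1 / y * (\<kappa> / y))" if "y \<noteq> 0" for y
      using that t by (simp add: field_simps)
    moreover have "1 - 1 / (1 + \<kappa>) = \<kappa> / (1 + \<kappa>)" "1 + \<kappa> \<noteq> 0"
      using \<kappa> by (simp_all add: field_simps)
    ultimately show ?thesis by (simp only: k_def not_False_eq_True)
  qed
  have Flim: "(\<lambda>n. F n a u) \<longlonglongrightarrow> of_real (exp (- (k * u\<^sup>2 / D / 2)) / sqrt D)" if "a < t" for a u
    unfolding F_def D_def
    by (rule tendsto_smoothed_char[OF p01 R(1) Rlim clim[OF that] plim centre[OF that] keq]) (use k in simp)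
  \<comment> \<open>The majorant needs a lower bound for the variance of one class; class 0 exists
    since \<open>t\<close> is positive. The bound holds from some \<open>n0\<close> on, hence the
    index shift below.\<close>
  have "(\<lambda>n. real (c n 0) / (R n)\<^sup>2 * (p n * (1 - p n))) \<longlonglongrightarrow> k"
    unfolding keq by (intro tendsto_intros clim plim t)
  then have "\<forall>\<^sub>F n in sequentially. k / 2 < real (c n 0) / (R n)\<^sup>2 * (p n * (1 - p n))"
    by (rule order_tendstoD) (use k in simp)
  then obtain n0 where n0: "\<And>n. n0 \<le> n \<Longrightarrow> k / 2 < real (c n 0) / (R n)\<^sup>2 * (p n * (1 - p n))"
    unfolding eventually_sequentially by blast
  define w where "w u = (2 + 144 / (k / 2) + 4 * \<mu>\<^sup>2) * (1 / (1 + u\<^sup>2))" for u :: real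
  have bound: "norm (indicator {- pi * R n..pi * R n} u *\<^sub>R (\<Prod>a<t. F n a u)) \<le> w u" if "n0 \<le> n" for n u
  proof (cases "\<bar>u\<bar> \<le> pi * R n")
    case True
    have var: "k / 2 * (R n)\<^sup>2 \<le> real (c n 0) * (p n * (1 - p n))"
      using n0[OF that] R(1)[of n] by (simp add: field_simps)
    have le1: "norm (F n a u) \<le> 1" for a unfolding F_def by (rule norm_smoothed_char_le_1[OF p01])
    \<comment> \<open>Only the factor of class 0 supplies decay in \<open>u\<close>; the others are
      bounded by 1.\<close>
    have "norm (\<Prod>a<t. F n a u) = norm (F n 0 u) * (\<Prod>a\<in>{..<t} - {0}. norm (F n a u))"
      using t by (simp add: prod_norm[symmetric] norm_mult prod.remove[of "{..<t}" 0])
    also have "\<dots> \<le> norm (F n 0 u) * 1"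
      by (intro mult_left_mono prod_le_1) (auto simp: le1)
    also have "\<dots> \<le> w u"
      using norm_smoothed_char_le[OF p01 R(1) _ var True] k by (simp add: F_def w_def)
    finally show ?thesis using True by (simp add: indicator_def abs_le_iff)
  next
    case False
    moreover have "0 \<le> w u" using k by (simp add: w_def add_nonneg_nonneg)
    ultimately show ?thesis by (auto simp: indicator_def abs_le_iff)
  qed
  have point: "(\<lambda>n. indicator {- pi * R n..pi * R n} u *\<^sub>R (\<Prod>a<t. F n a u)) \<longlonglongrightarrow>
    of_real ((exp (- (k * u\<^sup>2 / D / 2)) / sqrt D) ^ t)" for u
  proof -
    have "(\<lambda>n. \<Prod>a<t. F n a u) \<longlonglongrightarrow> (\<Prod>a<t. of_real (exp (- (k * u\<^sup>2 / D / 2)) / sqrt D))"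
      by (intro tendsto_prod) (simp only: lessThan_iff Flim)
    moreover have "\<forall>\<^sub>F n in sequentially. (\<Prod>a<t. F n a u) = indicator {- pi * R n..pi * R n} u *\<^sub>R (\<Prod>a<t. F n a u)"
      using filterlim_at_top_dense[THEN iffD1, OF Rlim, rule_format, of "\<bar>u\<bar> / pi"]
    proof eventually_elim
      case (elim n)
      then have "\<bar>u\<bar> \<le> pi * R n" by (simp add: divide_less_eq mult.commute)
      then show ?case by (simp add: indicator_def abs_le_iff)
    qed
    ultimately show ?thesis by (auto intro: Lim_transform_eventually)
  qed
  have "(\<lambda>n. \<integral>u. indicator {- pi * R (n + n0)..pi * R (n + n0)} u *\<^sub>R (\<Prod>a<t. F (n + n0) a u) \<partial>lborel) \<longlonglongrightarrow>
    (\<integral>u. of_real ((exp (- (k * u\<^sup>2 / D / 2)) / sqrt D) ^ t) \<partial>lborel)"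
  proof (rule integral_dominated_convergence[where w = w])
    show "integrable lborel w"
      unfolding w_def[abs_def] by (intro integrable_mult_right integrable_inverse_1_plus_square_lborel)
    show "AE u in lborel. (\<lambda>n. indicator {- pi * R (n + n0)..pi * R (n + n0)} u *\<^sub>R (\<Prod>a<t. F (n + n0) a u))
      \<longlonglongrightarrow> of_real ((exp (- (k * u\<^sup>2 / D / 2)) / sqrt D) ^ t)"
      by (intro AE_I2 LIMSEQ_ignore_initial_segment[OF point])
    show "AE u in lborel. norm (indicator {- pi * R (n + n0)..pi * R (n + n0)} u *\<^sub>R (\<Prod>a<t. F (n + n0) a u)) \<le> w u" for n
      by (intro AE_I2 bound) simp
  qed (simp_all add: F_def)
  then have "(\<lambda>n. \<integral>u. indicator {- pi * R n..pi * R n} u *\<^sub>R (\<Prod>a<t. F n a u) \<partial>lborel) \<longlonglongrightarrow>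
    (\<integral>u. of_real ((exp (- (k * u\<^sup>2 / D / 2)) / sqrt D) ^ t) \<partial>lborel)"
    by (rule LIMSEQ_offset)
  moreover have "(\<integral>u. complex_of_real ((exp (- (k * u\<^sup>2 / D / 2)) / sqrt D) ^ t) \<partial>lborel) =
    of_real (sqrt (2 * pi / (real t * k)) * (sqrt D / sqrt D ^ t))"
  proof -
    \<comment> \<open>The product has Gaussian exponent \<open>t * k / D\<close>, so integration
      over \<open>u\<close> returns one factor \<open>sqrt D\<close> against
      \<open>sqrt D ^ t\<close> in the denominator. The single constraint on the counts thus
      accounts for \<open>t - 1\<close> in the shape parameter.\<close>
    have "0 < real t * k / D" using t k D by simp
    from integral_gaussian(2)[OF this]
    have "(\<integral>u. exp (- (real t * k / D * u\<^sup>2 / 2)) \<partial>lborel) = sqrt (2 * pi / (real t * k)) * sqrt D"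
      by (simp add: real_sqrt_mult[symmetric])
    moreover have "(exp (- (k * u\<^sup>2 / D / 2)) / sqrt D) ^ t = exp (- (real t * k / D * u\<^sup>2 / 2)) / sqrt D ^ t" for u
      by (simp add: power_divide exp_of_nat_mult[symmetric] mult.assoc)
    ultimately show ?thesis by simp
  qed
  moreover have "(real (r n) - real a) / real t = d n - real a / real t" for n a
    by (simp add: d_def diff_divide_distrib)
  ultimately show ?thesis
    by (simp only: F_def c_def D_def) (simp only: d_def)
qed

text \<open>The value \<open>\<tau> = t * sqrt k / sqrt r\<close> matches the quadratic form in
  \<open>scaled_size_core\<close>, whose additive constant becomes an exponential prefactor tending
  to 1. The number of partitions in the box is \<open>S 0\<close>.\<close>

lemma laplace_scaled_core:
  fixes k :: real and r s :: nat
  assumes "0 < t" "0 < r" "0 \<le> k"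
  defines "S \<equiv> \<lambda>\<tau>. \<Sum>B\<in>{B. B \<subseteq> {..<r + s} \<and> card B = r}.
    exp (- (\<Sum>a<t. (\<tau> * (real (residue_count t B a) - (real r - real a) / real t))\<^sup>2) / 2)"
  shows "(\<integral>x. exp (- (k * x)) \<partial>distr (measure_pmf (pmf_of_set (box_partitions r s))) borel
      (\<lambda>l. real t * real (partition_size (core t l)) / real r)) =
    exp (k * (\<Sum>a<t. real a ^ 2) / 2 * (1 / real r)) * (S (real t * sqrt k / sqrt (real r)) / S 0)"
proof -
  define C where "C = exp (k * (\<Sum>a<t. real a ^ 2) / 2 * (1 / real r))"
  define q where "q B = (\<Sum>a<t. (real (residue_count t B a) - (real r - real a) / real t)\<^sup>2)" for B
  have S: "S \<tau> = (\<Sum>B\<in>{B. B \<subseteq> {..<r + s} \<and> card B = r}. exp (- (\<tau>\<^sup>2 * q B) / 2))" for \<tau>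
    by (simp add: S_def q_def power_mult_distrib sum_distrib_left)
  have box: "exp (- (k * (real t * real (partition_size (core t l)) / real r))) =
    C * exp (- ((real t * sqrt k / sqrt (real r))\<^sup>2 * q (beta_set r l)) / 2)" if "l \<in> box_partitions r s" for l
  proof -
    have l: "is_partition l" "length l \<le> r" using that by (auto simp: box_partitions_def)
    have "- (k * (real t * real (partition_size (core t l)) / real r)) =
      k * (\<Sum>a<t. real a ^ 2) / 2 * (1 / real r) + - ((real t * sqrt k / sqrt (real r))\<^sup>2 * q (beta_set r l)) / 2"
      unfolding scaled_size_core[OF l assms(1)] q_def
      using assms(2,3) by (simp add: field_simps)
    then show ?thesis by (simp only: C_def exp_add)
  qed
  have "(\<integral>x. exp (- (k * x)) \<partial>distr (measure_pmf (pmf_of_set (box_partitions r s))) borel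
      (\<lambda>l. real t * real (partition_size (core t l)) / real r)) =
    (\<integral>l. exp (- (k * (real t * real (partition_size (core t l)) / real r))) \<partial>measure_pmf (pmf_of_set (box_partitions r s)))"
    by (rule integral_distr) simp_all
  also have "\<dots> = (\<Sum>l\<in>box_partitions r s. exp (- (k * (real t * real (partition_size (core t l)) / real r))))
      / card (box_partitions r s)"
    by (rule integral_pmf_of_set) (simp_all add: finite_box_partitions box_partitions_nonempty)
  also have "(\<Sum>l\<in>box_partitions r s. exp (- (k * (real t * real (partition_size (core t l)) / real r)))) =
    C * S (real t * sqrt k / sqrt (real r))"
    unfolding S sum_distrib_left
    by (subst sum.reindex_bij_betw[OF bij_betw_beta_set, symmetric]) (intro sum.cong refl box)
  also have "real (card (box_partitions r s)) = S 0"
    unfolding S using bij_betw_same_card[OF bij_betw_beta_set] by simp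
  finally show ?thesis by (simp add: C_def)
qed

theorem theorem5p2:
  fixes t :: nat and \<kappa> :: real and r s :: "nat \<Rightarrow> nat"
  assumes "t \<ge> 2" and "\<kappa> > 0"
    and "\<And>n. r n > 0" and "\<And>n. s n > 0"
    and "filterlim r at_top sequentially" and "filterlim s at_top sequentially"
    and "(\<lambda>n. real (s n) / real (r n)) \<longlonglongrightarrow> \<kappa>"
  shows "weak_conv_m
           (\<lambda>n. distr (measure_pmf (pmf_of_set (box_partitions (r n) (s n)))) borel
                  (\<lambda>l. real t * real (partition_size (core t l)) / real (r n)))
           (gamma_distribution ((real t - 1) / 2) ((1 + \<kappa>) / (\<kappa> * real t)))"
proof -
  define \<alpha> \<beta> where "\<alpha> = (real t - 1) / 2" and "\<beta> = (1 + \<kappa>) / (\<kappa> * real t)"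
  define k where "k = \<kappa> / (real t * (1 + \<kappa>))"
  have t: "0 < t" using assms(1) by simp
  have pos: "0 < \<alpha>" "0 < \<beta>" "0 < k" using assms(1,2) by (simp_all add: \<alpha>_def \<beta>_def k_def)
  define m where "m n a = (real (r n) - real a) / real t" for n a
  define S where "S n \<tau> = (\<Sum>B\<in>{B. B \<subseteq> {..<r n + s n} \<and> card B = r n}.
    exp (- (\<Sum>a<t. (\<tau> * (real (residue_count t B a) - m n a))\<^sup>2) / 2))" for n \<tau>
  define p where "p n = real (r n) / real (r n + s n)" for n
  \<comment> \<open>The Fourier prefactor is common to numerator and denominator of the Laplace
    transform and cancels; it is nonzero because \<open>p n\<close> lies strictly between 0 and
    1.\<close>
  define c where "c n = 2 * pi * sqrt (real (r n)) * (p n ^ r n * (1 - p n) ^ (r n + s n - r n))" for n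
  have c: "c n \<noteq> 0" for n
  proof -
    have "p n \<noteq> 1" "p n \<noteq> 0" using assms(3)[of n] assms(4)[of n] by (simp_all add: p_def divide_eq_1_iff)
    then show ?thesis using assms(3)[of n] by (simp add: c_def)
  qed
  define L where "L \<mu> = sqrt (2 * pi / (real t * k)) * (sqrt (1 + k * \<mu>\<^sup>2) / sqrt (1 + k * \<mu>\<^sup>2) ^ t)" for \<mu>
  have lim: "(\<lambda>n. c n * S n (\<mu> / sqrt (real (r n)))) \<longlonglongrightarrow> L \<mu>" for \<mu>
  proof -
    have "(\<lambda>n. complex_of_real (c n * S n (\<mu> / sqrt (real (r n))))) \<longlonglongrightarrow> of_real (L \<mu>)"
      using tendsto_fourier_integral[OF t assms(2,3,5,7), of \<mu>]
        fourier_residue_counts[OF t, of "sqrt (real (r n))" "r n" "r n + s n" "p n" "\<mu> / sqrt (real (r n))" "m n" for n]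
        assms(3)
      unfolding c_def S_def L_def k_def p_def m_def by simp
    then show ?thesis by (simp only: tendsto_of_real_iff)
  qed
  have L0: "L 0 \<noteq> 0" using t pos by (simp add: L_def)
  show ?thesis
    unfolding \<alpha>_def[symmetric] \<beta>_def[symmetric]
  proof (rule weak_conv_m_laplace)
    show "real_distribution (distr (measure_pmf (pmf_of_set (box_partitions (r n) (s n)))) borel
        (\<lambda>l. real t * real (partition_size (core t l)) / real (r n)))" for n
      by (intro prob_space.real_distribution_distr prob_space_measure_pmf) simp
    show "real_distribution (gamma_distribution \<alpha> \<beta>)" using pos by (intro real_distribution_gamma)
    show "AE x in distr (measure_pmf (pmf_of_set (box_partitions (r n) (s n)))) borel
        (\<lambda>l. real t * real (partition_size (core t l)) / real (r n)). 0 \<le> x" for n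
      by (subst AE_distr_iff) simp_all
    show "AE x in gamma_distribution \<alpha> \<beta>. 0 \<le> x" by (rule AE_gamma_nonneg)
    fix j :: nat
    define \<mu> where "\<mu> = real t * sqrt (real j)"
    define D where "D = 1 + k * \<mu>\<^sup>2"
    have D: "0 < D" using pos(3) by (simp add: D_def add_pos_nonneg)
    have "(\<lambda>n. exp (real j * (\<Sum>a<t. real a ^ 2) / 2 * (1 / real (r n))) *
        ((c n * S n (\<mu> / sqrt (real (r n)))) / (c n * S n (0 / sqrt (real (r n)))))) \<longlonglongrightarrow>
      exp (real j * (\<Sum>a<t. real a ^ 2) / 2 * 0) * (L \<mu> / L 0)"
    proof (intro tendsto_intros lim L0)
      show "(\<lambda>n. 1 / real (r n)) \<longlonglongrightarrow> 0"
        using filterlim_compose[OF filterlim_real_sequentially assms(5)]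
        by (auto intro: tendsto_divide_0 filterlim_at_top_imp_at_infinity)
    qed
    moreover have "exp (real j * (\<Sum>a<t. real a ^ 2) / 2 * (1 / real (r n))) *
        ((c n * S n (\<mu> / sqrt (real (r n)))) / (c n * S n (0 / sqrt (real (r n))))) =
      (\<integral>x. exp (- (real j * x)) \<partial>distr (measure_pmf (pmf_of_set (box_partitions (r n) (s n)))) borel
        (\<lambda>l. real t * real (partition_size (core t l)) / real (r n)))" for n
      using laplace_scaled_core[OF t assms(3), of "real j" n "s n"] c[of n] by (simp add: S_def m_def \<mu>_def)
    moreover have "L \<mu> / L 0 = (\<beta> / (\<beta> + real j)) powr \<alpha>"
    proof -
      \<comment> \<open>The exponent of \<open>D\<close> becomes \<open>(1 - t) / 2\<close>, which
        is \<open>- \<alpha>\<close>, and \<open>k * \<mu>\<^sup>2 = j / \<beta>\<close> identifies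
        the base with that of \<open>laplace_gamma\<close>.\<close>
      have "L \<mu> / L 0 = sqrt D / sqrt D ^ t" using t pos by (simp add: L_def D_def)
      also have "\<dots> = D powr (1 / 2) / D powr (real t / 2)"
        using D by (simp add: powr_half_sqrt[symmetric] powr_realpow[symmetric] powr_powr)
      also have "\<dots> = D powr (- \<alpha>)"
        by (simp add: powr_diff[symmetric] \<alpha>_def diff_divide_distrib)
      also have "\<dots> = (1 / D) powr \<alpha>"
        using D by (simp add: powr_minus powr_divide inverse_eq_divide)
      also have "1 / D = \<beta> / (\<beta> + real j)"
      proof -
        have "k * \<mu>\<^sup>2 = real j / \<beta>"
        proof -
          have "\<kappa> / (real t * y) * ((real t)\<^sup>2 * real j) = real j / (y / (\<kappa> * real t))" if "y \<noteq> 0" for y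
            using that t assms(2) by (simp add: field_simps power2_eq_square)
          then show ?thesis using assms(2) by (simp add: k_def \<mu>_def \<beta>_def power_mult_distrib)
        qed
        then have "D = (\<beta> + real j) / \<beta>" using pos(2) by (simp add: D_def add_divide_distrib)
        then show ?thesis by simp
      qed
      finally show ?thesis .
    qed
    ultimately show "(\<lambda>n. \<integral>x. exp (- (real j * x)) \<partial>distr (measure_pmf (pmf_of_set (box_partitions (r n) (s n)))) borel
        (\<lambda>l. real t * real (partition_size (core t l)) / real (r n))) \<longlonglongrightarrow>
      (\<integral>x. exp (- (real j * x)) \<partial>gamma_distribution \<alpha> \<beta>)"
      using laplace_gamma[OF pos(1,2), of "real j"] by simp
  qed
qed

end
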